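(* Let $m\ge2$ and $n$ be natural numbers. Suppose that there exist nonconstant entire functions $f_1,\dots,f_{m+1}$ of order less than $1$ satisfying $$f_1^{\underline{n}}+f_2^{\underline{n}}+\cdots+f_m^{\underline{n}}=f_{m+1}^{\underline{n}}.$$ Further suppose that $f_1^{\underline{n}},\dots,f_{m+1}^{\underline{n}}$ are pairwise relatively shifting prime and that $f_1^{\underline{n}},\dots,f_m^{\underline{n}}$ are linearly independent over $\mathbb{C}$. Then $$n\le m^2-2.$$
   Context: For an entire function $f$ and an integer $n\ge1$, $f^{\underline{n}}:=f(z)f(z-1)\cdots f(z-n+1)$ (and $f^{\underline{0}}=1$). In particular $(z-z_0)^{\underline{n}}=(z-z_0)(z-z_0-1)\cdots(z-z_0-n+1)$. $\Delta f(z)=f(z+1)-f(z)$, $\Delta^0f=f$, $\Delta^k f=\Delta(\Delta^{k-1}f)$. Length of zeros. For an entire function $f$, a point $z_0$ is a zero of $f$ with length $n\ge 1$ if $\Delta^k f(z_0)=0$ for all $0\le k<n$ and $\Delta^n f(z_0)\ne0$. Relatively shifting prime. Let $f,g$ be entire, let $z_1$ be a zero of $f$ with length $m'$ and $z_2$ a zero of $g$ with length $n'$. For $1\le m_1\le m'$ and $1\le n_1\le n'$ there are entire $F,G$ with $f(z)=(z-z_1)^{\underline{m_1}}F(z)$ and $g(z)=(z-z_2)^{\underline{n_1}}G(z)$. If for some such $m_1,n_1$ one has $f(z)g(z)=(z-z_0)^{\underline{m_1+n_1}}F(z)G(z)$ with $z_0\in\{z_1,z_2\}$, then $z-z_0$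 is called a common shifting divisor of $f$ and $g$. If $f$ and $g$ have no common shifting divisor (for any choice of $z_1,z_2$), they are called relatively shifting prime. *)

theory Defs
  imports "HOL-Complex_Analysis.Complex_Analysis"
begin

abbreviation entire :: "(complex \<Rightarrow> complex) \<Rightarrow> bool" where
  "entire f \<equiv> f holomorphic_on UNIV"

text \<open>The shifted power \<open>f(z) f(z - 1) \<dots> f(z - n + 1)\<close>.\<close>

definition shift_pow :: "(complex \<Rightarrow> complex) \<Rightarrow> nat \<Rightarrow> complex \<Rightarrow> complex" where
  "shift_pow f n z = (\<Prod>j<n. f (z - of_nat j))"

definition fdiff :: "(complex \<Rightarrow> complex) \<Rightarrow> complex \<Rightarrow> complex" where
  "fdiff f z = f (z + 1) - f z"

definition zero_of_length :: "(complex \<Rightarrow> complex) \<Rightarrow> complex \<Rightarrow> nat \<Rightarrow> bool" where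
  "zero_of_length f z\<^sub>0 n \<longleftrightarrow>
     n \<ge> 1 \<and> (\<forall>k<n. (fdiff ^^ k) f z\<^sub>0 = 0) \<and> (fdiff ^^ n) f z\<^sub>0 \<noteq> 0"

text \<open>\<open>common_shifting_divisor f g z\<^sub>0\<close>: the linear polynomial \<open>z - z\<^sub>0\<close> is a common
  shifting divisor of \<open>f\<close> and \<open>g\<close>.\<close>

definition common_shifting_divisor ::
  "(complex \<Rightarrow> complex) \<Rightarrow> (complex \<Rightarrow> complex) \<Rightarrow> complex \<Rightarrow> bool" where
  "common_shifting_divisor f g z\<^sub>0 \<longleftrightarrow>
     (\<exists>z\<^sub>1 z\<^sub>2 m' n' m\<^sub>1 n\<^sub>1 F G.
        zero_of_length f z\<^sub>1 m' \<and> zero_of_length g z\<^sub>2 n' \<and>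
        1 \<le> m\<^sub>1 \<and> m\<^sub>1 \<le> m' \<and> 1 \<le> n\<^sub>1 \<and> n\<^sub>1 \<le> n' \<and>
        entire F \<and> entire G \<and>
        (\<forall>z. f z = shift_pow (\<lambda>w. w - z\<^sub>1) m\<^sub>1 z * F z) \<and>
        (\<forall>z. g z = shift_pow (\<lambda>w. w - z\<^sub>2) n\<^sub>1 z * G z) \<and>
        z\<^sub>0 \<in> {z\<^sub>1, z\<^sub>2} \<and>
        (\<forall>z. f z * g z = shift_pow (\<lambda>w. w - z\<^sub>0) (m\<^sub>1 + n\<^sub>1) z * F z * G z))"

definition relatively_shifting_prime ::
  "(complex \<Rightarrow> complex) \<Rightarrow> (complex \<Rightarrow> complex) \<Rightarrow> bool" where
  "relatively_shifting_prime f g \<longleftrightarrow> (\<nexists>z\<^sub>0. common_shifting_divisor f g z\<^sub>0)"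

definition max_modulus :: "(complex \<Rightarrow> complex) \<Rightarrow> real \<Rightarrow> real" where
  "max_modulus f r = (SUP z\<in>sphere 0 r. norm (f z))"

definition log_plus :: "real \<Rightarrow> real" where
  "log_plus x = ln (max 1 x)"

text \<open>The order of growth of an entire function, \<open>limsup log log M(r, f) / log r\<close> as
  \<open>r \<rightarrow> \<infinity>\<close>; using \<open>log_plus\<close> only matters for constant functions, which get order \<open>0\<close>.\<close>

definition growth_order :: "(complex \<Rightarrow> complex) \<Rightarrow> ereal" where
  "growth_order f =
     Limsup at_top (\<lambda>r. ereal (log_plus (log_plus (max_modulus f r)) / ln r))"

text \<open>Linear independence over the complex numbers of a finite indexed family of functions; unlike
  independence of the set of its members, this rules out repetitions.\<close>

definition lin_indep_family :: "'i set \<Rightarrow> ('i \<Rightarrow> complex \<Rightarrow> complex) \<Rightarrow> bool" where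
  "lin_indep_family I F \<longleftrightarrow>
     (\<forall>c :: 'i \<Rightarrow> complex. (\<forall>z. (\<Sum>i\<in>I. c i * F i z) = 0) \<longrightarrow> (\<forall>i\<in>I. c i = 0))"

end

theory Submission
  imports Defs "HOL-Real_Asymp.Real_Asymp" "Jordan_Normal_Form.Determinant"
begin

text \<open>
  Let \<open>C\<close> be the Casoratian of the \<open>n\<close>th shifted powers of \<open>f\<^sub>1, \<dots>, f\<^sub>m\<close>. Functions of order
  less than \<open>1\<close> admit arbitrarily large circles on which every bounded shift changes them only by a
  factor close to \<open>1\<close>. This has two consequences: periodic quotients of such functions are
  constant, so linear independence forces \<open>C \<noteq> 0\<close>; and on such circles \<open>C\<close> is much smaller than
  \<open>\<Prod>\<^sub>i \<bar>f\<^sub>i\<bar>\<^sup>n\<close> taken over any \<open>m\<close> of the \<open>m + 1\<close> indices, because it factors through the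
  determinant of a matrix close to the all-ones matrix; at each point the index with the
  largest \<open>\<bar>f\<^sub>i\<bar>\<close> is omitted. On the other hand \<open>C\<close> is divisible by each shifted power of \<open>f\<^sub>i\<close> of
  length \<open>n + 1 - m\<close>, hence by their product, since relative shifting primality excludes common
  zeros. If \<open>n \<ge> m\<^sup>2 - 1\<close>, the quotient times \<open>f\<^sub>1\<close> to the power \<open>n + 1 - m\<^sup>2\<close> tends to \<open>0\<close> along the
  circles, so it vanishes by the maximum principle, a contradiction.
\<close>

section \<open>Entire functions of order less than 1\<close>

text \<open>Order less than 1 as one explicit bound on the whole plane; in this form closure under
  sums, products and shifts is a direct estimate. The base \<open>1 + norm z\<close> is at least 1,
  so raising the exponent only weakens the bound.\<close>

definition small_growth :: "(complex \<Rightarrow> complex) \<Rightarrow> bool" where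
  "small_growth f \<longleftrightarrow> entire f \<and>
     (\<exists>\<rho> C. 0 < \<rho> \<and> \<rho> < 1 \<and> 0 \<le> C \<and> (\<forall>z. norm (f z) \<le> exp (C * (1 + norm z) powr \<rho>)))"

lemma small_growth_entire: "small_growth f \<Longrightarrow> entire f"
  by (simp add: small_growth_def)

lemma small_growth_common_bound:
  assumes "small_growth f" "small_growth g"
  obtains \<rho> C where "0 < \<rho>" "\<rho> < 1" "0 \<le> C"
    "\<And>z. norm (f z) \<le> exp (C * (1 + norm z) powr \<rho>)"
    "\<And>z. norm (g z) \<le> exp (C * (1 + norm z) powr \<rho>)"
proof -
  obtain \<rho>1 C1 where 1: "0 < \<rho>1" "\<rho>1 < 1" "0 \<le> C1"
      "\<And>z. norm (f z) \<le> exp (C1 * (1 + norm z) powr \<rho>1)"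
    using assms(1) unfolding small_growth_def by blast
  obtain \<rho>2 C2 where 2: "0 < \<rho>2" "\<rho>2 < 1" "0 \<le> C2"
      "\<And>z. norm (g z) \<le> exp (C2 * (1 + norm z) powr \<rho>2)"
    using assms(2) unfolding small_growth_def by blast
  have le: "exp (C' * (1 + norm z) powr \<rho>') \<le> exp (max C1 C2 * (1 + norm z) powr (max \<rho>1 \<rho>2))"
    if "C' \<le> max C1 C2" "\<rho>' \<le> max \<rho>1 \<rho>2" "0 \<le> C'" for C' \<rho>' and z :: complex
    using that by (auto intro!: mult_mono powr_mono)
  show ?thesis
  proof (rule that)
    show "norm (f z) \<le> exp (max C1 C2 * (1 + norm z) powr (max \<rho>1 \<rho>2))" for z
      by (rule order_trans[OF 1(4) le]) (use 1 in auto)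
    show "norm (g z) \<le> exp (max C1 C2 * (1 + norm z) powr (max \<rho>1 \<rho>2))" for z
      by (rule order_trans[OF 2(4) le]) (use 2 in auto)
  qed (use 1 2 in auto)
qed

lemma small_growth_add:
  assumes "small_growth f" "small_growth g"
  shows "small_growth (\<lambda>z. f z + g z)"
proof -
  obtain \<rho> C where *: "0 < \<rho>" "\<rho> < 1" "0 \<le> C"
    "\<And>z. norm (f z) \<le> exp (C * (1 + norm z) powr \<rho>)"
    "\<And>z. norm (g z) \<le> exp (C * (1 + norm z) powr \<rho>)"
    using small_growth_common_bound[OF assms] by blast
  have "norm (f z + g z) \<le> exp ((C + 1) * (1 + norm z) powr \<rho>)" for z
  proof -
    have "1 \<le> (1 + norm z) powr \<rho>"
      using * by (intro ge_one_powr_ge_zero) auto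
    moreover have "(2::real) \<le> exp 1"
      using exp_ge_add_one_self[of "1::real"] by simp
    ultimately have "2 \<le> exp ((1 + norm z) powr \<rho>)"
      by (meson exp_le_cancel_iff order_trans)
    then have "2 * exp (C * (1 + norm z) powr \<rho>) \<le> exp ((1 + norm z) powr \<rho>) * exp (C * (1 + norm z) powr \<rho>)"
      by (intro mult_right_mono) auto
    also have "\<dots> = exp ((C + 1) * (1 + norm z) powr \<rho>)"
      by (simp add: algebra_simps exp_add)
    finally show ?thesis
      using *(4,5)[of z] norm_triangle_ineq[of "f z" "g z"] by linarith
  qed
  with * show ?thesis
    using assms unfolding small_growth_def
    by (intro conjI exI[of _ \<rho>] exI[of _ "C + 1"] holomorphic_intros) auto
qed

lemma small_growth_mult:
  assumes "small_growth f" "small_growth g"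
  shows "small_growth (\<lambda>z. f z * g z)"
proof -
  obtain \<rho> C where *: "0 < \<rho>" "\<rho> < 1" "0 \<le> C"
    "\<And>z. norm (f z) \<le> exp (C * (1 + norm z) powr \<rho>)"
    "\<And>z. norm (g z) \<le> exp (C * (1 + norm z) powr \<rho>)"
    using small_growth_common_bound[OF assms] by blast
  have "norm (f z * g z) \<le> exp ((C + C) * (1 + norm z) powr \<rho>)" for z
    unfolding norm_mult ring_distribs exp_add by (intro mult_mono *) auto
  with * show ?thesis
    using assms unfolding small_growth_def
    by (intro conjI exI[of _ \<rho>] exI[of _ "C + C"] holomorphic_intros) auto
qed

lemma small_growth_const [simp]: "small_growth (\<lambda>_. c)"
proof -
  have "norm c \<le> exp (norm c * (1 + norm z) powr (1/2))" for z :: complex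
  proof -
    have "norm c * 1 \<le> norm c * (1 + norm z) powr (1/2)"
      by (intro mult_left_mono ge_one_powr_ge_zero) auto
    also have "\<dots> \<le> exp (norm c * (1 + norm z) powr (1/2))"
      using exp_ge_add_one_self[of "norm c * (1 + norm z) powr (1/2)"] by linarith
    finally show ?thesis by simp
  qed
  then show ?thesis
    unfolding small_growth_def by (intro conjI exI[of _ "1/2"] exI[of _ "norm c"]) auto
qed

lemma small_growth_cmult: "small_growth f \<Longrightarrow> small_growth (\<lambda>z. c * f z)"
  by (intro small_growth_mult) auto

lemma small_growth_diff:
  assumes "small_growth f" "small_growth g"
  shows "small_growth (\<lambda>z. f z - g z)"
  using small_growth_add[OF assms(1) small_growth_cmult[OF assms(2), of "-1"]] by simp

lemma small_growth_sum:
  "(\<And>i. i \<in> I \<Longrightarrow> small_growth (f i)) \<Longrightarrow> small_growth (\<lambda>z. \<Sum>i\<in>I. f i z)"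
  by (induction I rule: infinite_finite_induct) (auto intro: small_growth_add)

lemma small_growth_prod:
  "(\<And>i. i \<in> I \<Longrightarrow> small_growth (f i)) \<Longrightarrow> small_growth (\<lambda>z. \<Prod>i\<in>I. f i z)"
  by (induction I rule: infinite_finite_induct) (auto intro: small_growth_mult)

lemma small_growth_shift:
  assumes "small_growth f"
  shows "small_growth (\<lambda>z. f (z + a))"
proof -
  obtain \<rho> C where *: "0 < \<rho>" "\<rho> < 1" "0 \<le> C"
    "\<And>z. norm (f z) \<le> exp (C * (1 + norm z) powr \<rho>)"
    using assms unfolding small_growth_def by blast
  have "norm (f (z + a)) \<le> exp (C * (1 + norm a) powr \<rho> * (1 + norm z) powr \<rho>)" for z
  proof -
    have "1 + norm (z + a) \<le> 1 + norm z + norm a"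
      using norm_triangle_ineq[of z a] by simp
    also have "\<dots> \<le> (1 + norm a) * (1 + norm z)"
      by (simp add: algebra_simps)
    finally have "C * (1 + norm (z + a)) powr \<rho> \<le> C * ((1 + norm a) * (1 + norm z)) powr \<rho>"
      using * by (intro mult_left_mono powr_mono2) auto
    also have "\<dots> = C * (1 + norm a) powr \<rho> * (1 + norm z) powr \<rho>"
      by (simp add: powr_mult)
    finally show ?thesis
      using *(4)[of "z + a"] by (meson exp_le_cancel_iff order_trans)
  qed
  moreover have "entire (\<lambda>z. f (z + a))"
    using holomorphic_on_compose_gen[of "\<lambda>z. z + a" UNIV f UNIV, unfolded o_def]
      small_growth_entire[OF assms] by (simp add: holomorphic_on_add)
  ultimately show ?thesis
    using * unfolding small_growth_def
    by (intro conjI exI[of _ \<rho>] exI[of _ "C * (1 + norm a) powr \<rho>"]) auto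
qed

lemma small_growth_shift_minus: "small_growth f \<Longrightarrow> small_growth (\<lambda>z. f (z - a))"
  using small_growth_shift[of f "-a"] by simp

lemma small_growth_shift_pow: "small_growth f \<Longrightarrow> small_growth (shift_pow f n)"
  unfolding shift_pow_def[abs_def] by (intro small_growth_prod small_growth_shift_minus)

lemma small_growth_if_growth_order_less_1:
  assumes "entire f" "growth_order f < 1"
  shows "small_growth f"
proof -
  obtain \<rho>' where "growth_order f < ereal \<rho>'" "ereal \<rho>' < 1"
    using ereal_dense2[OF assms(2)] by blast
  \<comment> \<open>Nothing so far makes \<open>\<rho>'\<close> positive; any larger exponent below
    1 serves as well.\<close>
  define \<rho> where "\<rho> = max \<rho>' (1/2)"
  have \<rho>: "0 < \<rho>" "\<rho> < 1" "growth_order f < ereal \<rho>"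
  proof -
    show "growth_order f < ereal \<rho>"
      using \<open>growth_order f < ereal \<rho>'\<close> by (rule less_le_trans) (simp add: \<rho>_def)
  qed (use \<open>ereal \<rho>' < 1\<close> in \<open>auto simp: \<rho>_def\<close>)
  have "eventually (\<lambda>r. ereal (log_plus (log_plus (max_modulus f r)) / ln r) < ereal \<rho>) at_top"
    using \<rho>(3) Limsup_lessD unfolding growth_order_def by blast
  then have "eventually (\<lambda>r. log_plus (log_plus (max_modulus f r)) / ln r < \<rho>) at_top"
    by simp
  then obtain R where R: "\<And>r. r \<ge> R \<Longrightarrow> log_plus (log_plus (max_modulus f r)) / ln r < \<rho>"
    by (auto simp: eventually_at_top_linorder)
  define R' where "R' = max R 2"
  have cont: "continuous_on A (\<lambda>z. norm (f z))" for A
    using assms(1) by (intro continuous_intros holomorphic_on_imp_continuous_on) (auto intro: holomorphic_on_subset)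
  have big: "norm (f z) \<le> exp (norm z powr \<rho>)" if z: "norm z \<ge> R'" for z
  proof -
    define r where "r = norm z"
    have r: "r \<ge> R" "r \<ge> 2" using z by (auto simp: r_def R'_def)
    have "bdd_above ((\<lambda>z. norm (f z)) ` sphere 0 r)"
      by (intro bounded_imp_bdd_above compact_imp_bounded compact_continuous_image cont) auto
    then have "norm (f z) \<le> max_modulus f r"
      unfolding max_modulus_def by (intro cSUP_upper) (auto simp: r_def)
    also have "max_modulus f r \<le> exp (r powr \<rho>)"
    proof -
      have "log_plus (log_plus (max_modulus f r)) < \<rho> * ln r"
        using R[OF r(1)] r(2) by (simp add: field_simps)
      then have "ln (max 1 (log_plus (max_modulus f r))) < ln (r powr \<rho>)"
        using r by (simp add: log_plus_def ln_powr)
      then have "max 1 (log_plus (max_modulus f r)) < r powr \<rho>"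
        using r by (subst (asm) ln_less_cancel_iff) auto
      then have "ln (max 1 (max_modulus f r)) < r powr \<rho>"
        by (simp add: log_plus_def)
      then have "exp (ln (max 1 (max_modulus f r))) < exp (r powr \<rho>)"
        by (subst exp_less_cancel_iff)
      then show ?thesis by (simp add: exp_ln)
    qed
    finally show ?thesis by (simp add: r_def)
  qed
  have "bdd_above ((\<lambda>z. norm (f z)) ` cball 0 R')"
    by (intro bounded_imp_bdd_above compact_imp_bounded compact_continuous_image cont) auto
  then obtain B where B: "\<And>z. norm z \<le> R' \<Longrightarrow> norm (f z) \<le> B"
    unfolding bdd_above_def by (metis image_eqI mem_cball_0)
  \<comment> \<open>One constant for both regions: far out the factor 1 suffices, and inside the
    disc the bound \<open>B\<close> is absorbed by \<open>x \<le> exp x\<close>.\<close>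
  define C where "C = max 1 B"
  have "norm (f z) \<le> exp (C * (1 + norm z) powr \<rho>)" for z
  proof (cases "norm z \<ge> R'")
    case True
    have "norm z powr \<rho> \<le> (1 + norm z) powr \<rho>"
      using \<rho> by (intro powr_mono2) auto
    also have "1 * (1 + norm z) powr \<rho> \<le> C * (1 + norm z) powr \<rho>"
      by (intro mult_right_mono) (auto simp: C_def)
    finally show ?thesis
      using big[OF True] by (simp add: order_trans[OF big[OF True]])
  next
    case False
    then have "norm (f z) \<le> C" using B[of z] by (simp add: C_def)
    also have "C * 1 \<le> C * (1 + norm z) powr \<rho>"
      using \<rho> by (intro mult_left_mono ge_one_powr_ge_zero) (auto simp: C_def)
    also have "\<dots> \<le> exp (C * (1 + norm z) powr \<rho>)"
      using exp_ge_add_one_self[of "C * (1 + norm z) powr \<rho>"] by linarith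
    finally show ?thesis by simp
  qed
  with \<rho> assms show ?thesis
    unfolding small_growth_def by (intro conjI exI[of _ \<rho>] exI[of _ C]) (auto simp: C_def)
qed

section \<open>Zero sets of entire functions\<close>

lemma entire_continuous_on: "entire f \<Longrightarrow> continuous_on A f"
  by (rule continuous_on_subset[OF holomorphic_on_imp_continuous_on]) auto

lemma entire_countable_zeros:
  assumes "entire f" "f w \<noteq> 0"
  shows "countable {z. f z = 0}"
proof (cases "f constant_on UNIV")
  case True
  then have "{z. f z = 0} = {}"
    using assms(2) by (metis (mono_tags, lifting) UNIV_I constant_on_def empty_Collect_eq)
  then show ?thesis by simp
next
  case False
  then have "countable {z\<in>UNIV. f z = 0}"
    by (intro holomorphic_countable_zeros assms(1)) (auto intro: fsigma_UNIV)
  then show ?thesis by simp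
qed

text \<open>Countably many countable zero sets cannot cover the plane. This supplies both a common
  base point for finitely many functions and an orbit \<open>z + k\<close> free of zeros.\<close>

lemma entire_common_nonzero:
  assumes "countable I" "\<And>i. i \<in> I \<Longrightarrow> entire (f i)" "\<And>i. i \<in> I \<Longrightarrow> \<exists>w. f i w \<noteq> 0"
  shows "\<exists>z. \<forall>i\<in>I. f i z \<noteq> 0"
proof -
  have "countable (\<Union>i\<in>I. {z. f i z = 0})"
    using assms entire_countable_zeros by (intro countable_UN) blast+
  then have "(\<Union>i\<in>I. {z. f i z = 0}) \<noteq> UNIV"
    using uncountable_UNIV_complex by metis
  then show ?thesis by auto
qed

lemma entire_mult_eq_0:
  assumes "entire f" "entire g" "\<And>z. f z * g z = 0"
  shows "(\<forall>z. f z = 0) \<or> (\<forall>z. g z = 0)"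
proof (rule ccontr)
  assume "\<not> ?thesis"
  then have "\<exists>z. \<forall>i\<in>(UNIV::bool set). (if i then f else g) z \<noteq> 0"
    using assms by (intro entire_common_nonzero) auto
  then show False using assms(3) by (metis UNIV_I mult_eq_0_iff)
qed

section \<open>Local factorisation\<close>

lemma entire_divide_linear:
  assumes "entire h" "h a = 0"
  obtains h' where "entire h'" "\<And>z. h z = (z - a) * h' z"
proof
  let ?h' = "\<lambda>z. if z = a then deriv h a else (h z - h a) / (z - a)"
  show "entire ?h'" using assms by (intro pole_lemma) auto
  show "h z = (z - a) * ?h' z" for z using assms by auto
qed

lemma maximum_modulus_circle:
  assumes "entire f" "\<And>z. norm (z - b) = r \<Longrightarrow> norm (f z) \<le> B" "norm (z - b) \<le> r"
  shows "norm (f z) \<le> B"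
proof (rule maximum_modulus_frontier[of f "cball b r"])
  show "f holomorphic_on interior (cball b r)" "continuous_on (closure (cball b r)) f"
    using assms(1) entire_continuous_on by (auto intro: holomorphic_on_subset)
  show "norm (f w) \<le> B" if "w \<in> frontier (cball b r)" for w
    using that assms(2)[of w] by (cases "r \<ge> 0") (auto simp: dist_norm norm_minus_commute)
qed (use assms(3) in \<open>auto simp: dist_norm norm_minus_commute\<close>)

text \<open>A substitute for Jensen's formula. The factors \<open>1 - z / a k\<close> equal 1 at 0,
  so \<open>h 0 = f 0\<close>, and \<open>B / norm (f 0)\<close> limits the number of zeros; the
  same maximum principle keeps \<open>h\<close> bounded by \<open>B\<close> on the larger
  disc.\<close>

lemma factor_out_zeros:
  assumes f: "entire f" "f 0 \<noteq> 0" and T: "T > 0"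
    and B: "\<And>z. norm z = 3 * T \<Longrightarrow> norm (f z) \<le> B"
  obtains N a h where "entire h" "\<And>z. f z = (\<Prod>k<N. 1 - z / a k) * h z"
    "\<And>k. k < N \<Longrightarrow> a k \<noteq> 0 \<and> norm (a k) \<le> T" "\<And>z. norm z \<le> T \<Longrightarrow> h z \<noteq> 0"
    "2 ^ N * norm (f 0) \<le> B" "\<And>z. norm z \<le> 3 * T \<Longrightarrow> norm (h z) \<le> B"
proof -
  define P where "P = (\<lambda>(N::nat) a h. entire h \<and> (\<forall>z. f z = (\<Prod>k<N. 1 - z / a k) * h z) \<and>
    (\<forall>k<N. a k \<noteq> 0 \<and> norm (a k) \<le> T))"
  \<comment> \<open>Each factor has modulus at least \<open>2\<close> on the circle of radius \<open>3 * T\<close>, so the number of factors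
    is bounded and a maximal factorisation exists.\<close>
  have growth: "2 ^ N * norm (h z) \<le> B" if "P N a h" "norm z \<le> 3 * T" for N a h z
  proof -
    have "norm (2 ^ N * h z) \<le> B"
    proof (rule maximum_modulus_circle[of "\<lambda>z. 2 ^ N * h z" 0 "3 * T"])
      show "entire (\<lambda>z. 2 ^ N * h z)" using that by (auto simp: P_def intro!: holomorphic_intros)
      fix w :: complex assume w: "norm (w - 0) = 3 * T"
      have "2 \<le> norm (1 - w / a k)" if "k < N" for k
      proof -
        have a: "a k \<noteq> 0" "norm (a k) \<le> T" using that \<open>P N a h\<close> by (auto simp: P_def)
        then have "3 \<le> norm (w / a k)" using w T by (simp add: norm_divide field_simps)
        then show ?thesis using norm_triangle_ineq2[of "w / a k" 1] by (simp add: norm_minus_commute)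
      qed
      then have "(\<Prod>k<N. 2) \<le> (\<Prod>k<N. norm (1 - w / a k))"
        by (intro prod_mono) auto
      then have "2 ^ N * norm (h w) \<le> norm (f w)"
        using that by (simp add: P_def norm_mult prod_norm mult_right_mono)
      then show "norm (2 ^ N * h w) \<le> B" using B[of w] w by (simp add: norm_mult norm_power)
    qed (use that in auto)
    then show ?thesis by (simp add: norm_mult norm_power)
  qed
  have f0: "h 0 = f 0" if "P N a h" for N a h using that by (simp add: P_def)
  have P0: "\<exists>a h. P 0 a h" using f by (auto simp: P_def)
  obtain L :: nat where L: "B / norm (f 0) < 2 ^ L"
    using real_arch_pow[of 2 "B / norm (f 0)"] by auto
  have bound: "N \<le> L" if "\<exists>a h. P N a h" for N
  proof (rule ccontr)
    assume "\<not> N \<le> L"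
    then have "(2::real) ^ L \<le> 2 ^ N" by (intro power_increasing) auto
    moreover from that obtain a h where "P N a h" by blast
    then have "2 ^ N * norm (f 0) \<le> B" using growth[of N a h 0] T f0 by auto
    then have "2 ^ N \<le> B / norm (f 0)" using f(2) by (simp add: field_simps)
    ultimately show False using L by linarith
  qed
  define N where "N = (GREATEST N. \<exists>a h. P N a h)"
  have "\<exists>a h. P N a h"
    unfolding N_def using P0 bound by (rule GreatestI_nat)
  then obtain a h where P: "P N a h" by blast
  \<comment> \<open>A zero of \<open>h\<close> in the small disc would split off as one more
    normalised factor, against the maximality of \<open>N\<close>.\<close>
  have "h z \<noteq> 0" if z: "norm z \<le> T" for z
  proof
    assume "h z = 0"
    then have "z \<noteq> 0" using f0[OF P] f(2) by auto
    obtain h' where h': "entire h'" "\<And>w. h w = (w - z) * h' w"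
      using entire_divide_linear[of h z] P \<open>h z = 0\<close> by (auto simp: P_def)
    have "h w = (1 - w / z) * (- z * h' w)" for w
    proof -
      have "(1 - w / z) * - z = w - z" using \<open>z \<noteq> 0\<close> by (simp add: field_simps)
      then show ?thesis using h'(2)[of w] by (metis mult.assoc)
    qed
    then have "P (Suc N) (a(N := z)) (\<lambda>w. - z * h' w)"
      using P h'(1) \<open>z \<noteq> 0\<close> z by (auto simp: P_def less_Suc_eq intro!: holomorphic_intros)
    then have "Suc N \<le> N"
      unfolding N_def using bound by (intro Greatest_le_nat) auto
    then show False by simp
  qed
  moreover have "norm (h z) \<le> B" if "norm z \<le> 3 * T" for z
  proof -
    have "1 * norm (h z) \<le> 2 ^ N * norm (h z)" by (intro mult_right_mono) auto
    then show ?thesis using growth[OF P that] by linarith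
  qed
  moreover have "2 ^ N * norm (f 0) \<le> B" using growth[OF P, of 0] f0[OF P] T by simp
  ultimately show ?thesis using P by (intro that[of h a N]) (auto simp: P_def)
qed

section \<open>Zero-free functions under shifts\<close>

text \<open>The map \<open>u / (2 * A - u)\<close> sends the half-plane \<open>Re u < A\<close> into
  the unit disc and fixes 0, so the Schwarz lemma applies after rescaling. At radius 3/4 it gives
  4|f| <= 3(2A + |f|), hence the constant 6.\<close>

lemma Borel_Caratheodory_at_0:
  assumes hol: "f holomorphic_on ball 0 T" and T: "T > 0" and f0: "f 0 = 0"
    and A: "A > 0" "\<And>z. norm z < T \<Longrightarrow> Re (f z) < A"
    and z: "norm z \<le> 3 / 4 * T"
  shows "norm (f z) \<le> 6 * A"
proof -
  define \<phi> where "\<phi> = (\<lambda>w. f (of_real T * w) / (2 * of_real A - f (of_real T * w)))"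
  have in_ball: "norm (of_real T * w) < T" if "norm w < 1" for w :: complex
    using that T by (simp add: norm_mult)
  have ne: "2 * of_real A - f (of_real T * w) \<noteq> 0" if "norm w < 1" for w
  proof
    assume "2 * of_real A - f (of_real T * w) = 0"
    then have "Re (f (of_real T * w)) = 2 * A" by (metis Re_complex_of_real eq_iff_diff_eq_0 of_real_mult of_real_numeral)
    with A(2)[OF in_ball[OF that]] A(1) show False by simp
  qed
  have "norm (\<phi> w) \<le> norm w" if "norm w < 1" for w
  proof (rule Schwarz_Lemma(1)[OF _ _ _ that])
    have "(f \<circ> (\<lambda>w. of_real T * w)) holomorphic_on ball 0 1"
      by (rule holomorphic_on_compose_gen[OF _ hol]) (auto intro!: holomorphic_intros in_ball[simplified])
    then show "\<phi> holomorphic_on ball 0 1"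
      unfolding \<phi>_def o_def using ne by (intro holomorphic_intros) auto
    show "\<phi> 0 = 0" by (simp add: \<phi>_def f0)
    fix w :: complex assume w: "norm w < 1"
    define u where "u = f (of_real T * w)"
    have "Re u < A" using A(2)[OF in_ball[OF w]] by (simp add: u_def)
    then have "(norm u)\<^sup>2 < (norm (2 * of_real A - u))\<^sup>2"
      using A(1) unfolding cmod_power2 by (simp add: power2_eq_square algebra_simps)
    then have "norm u < norm (2 * of_real A - u)"
      by (rule power2_less_imp_less) auto
    then show "norm (\<phi> w) < 1" using ne[OF w] by (simp add: \<phi>_def u_def norm_divide)
  qed
  moreover define w where "w = z / of_real T"
  have w: "norm w \<le> 3 / 4" "of_real T * w = z" using z T by (auto simp: w_def norm_divide field_simps)
  moreover from this have "norm w < 1" by simp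
  ultimately have "norm (\<phi> w) \<le> 3 / 4" using order_trans by blast
  then have "4 * norm (f z) \<le> 3 * norm (2 * of_real A - f z)"
    using ne[of w] w by (simp add: \<phi>_def norm_divide field_simps)
  also have "norm (2 * of_real A - f z) \<le> 2 * A + norm (f z)"
    using norm_triangle_ineq4[of "2 * of_real A" "f z"] A(1) by (simp add: norm_mult)
  finally show ?thesis by simp
qed

text \<open>Take a logarithm \<open>L\<close> of \<open>h\<close> on the disc. Its real part exceeds
  that at 0 by at most \<open>2 * M\<close>, so Borel-Caratheodory with \<open>A = 3 * M\<close>
  bounds \<open>L - L 0\<close> by 18M. Cauchy's inequality on discs of radius \<open>T / 4\<close>
  gives |L'| <= 72M/T on the half disc, and \<open>u\<close> is the increment of
  \<open>L\<close>.\<close>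

lemma zero_free_shift:
  assumes h: "entire h" "\<And>z. norm z \<le> T \<Longrightarrow> h z \<noteq> 0" and T: "T > 0" and M: "M > 0"
    and up: "\<And>z. norm z \<le> T \<Longrightarrow> norm (h z) \<le> exp M" and low: "exp (- M) \<le> norm (h 0)"
    and z: "norm z \<le> T / 2" "norm (z + w) \<le> T / 2"
  obtains u where "h (z + w) = h z * exp u" "norm u \<le> 72 * M / T * norm w"
proof -
  obtain L where L: "L holomorphic_on ball 0 T" "\<And>z. z \<in> ball 0 T \<Longrightarrow> exp (L z) = h z"
    using holomorphic_logarithm_exists[of "ball 0 T" h 0] h T
    by (auto intro: holomorphic_on_subset)
  have Re_L: "norm (h z) = exp (Re (L z))" if "norm z < T" for z
    using L(2)[of z] that by (metis mem_ball_0 norm_exp_eq_Re)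
  have bound: "norm (L x - L 0) \<le> 6 * (3 * M)" if "norm x \<le> 3 / 4 * T" for x
  proof (rule Borel_Caratheodory_at_0[where f = "\<lambda>z. L z - L 0"])
    show "(\<lambda>z. L z - L 0) holomorphic_on ball 0 T" using L by (intro holomorphic_intros)
    fix y :: complex assume "norm y < T"
    then have "Re (L y) \<le> M" using up[of y] Re_L[of y] by simp
    moreover have "- M \<le> Re (L 0)" using low Re_L[of 0] T by simp
    ultimately show "Re (L y - L 0) < 3 * M" using M by simp
  qed (use that T M in auto)
  have deriv_bound: "norm (deriv L x) \<le> 72 * M / T" if "norm x \<le> T / 2" for x
  proof -
    have sub: "cball x (T / 4) \<subseteq> ball 0 T"
    proof
      fix y assume "y \<in> cball x (T / 4)"
      then have "norm (y - x) \<le> T / 4" by (simp add: dist_norm norm_minus_commute)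
      then show "y \<in> ball 0 T" using norm_triangle_ineq[of "y - x" x] that T by simp
    qed
    have "norm ((deriv ^^ 1) (\<lambda>z. L z - L 0) x) \<le> fact 1 * (6 * (3 * M)) / (T / 4) ^ 1"
    proof (rule Cauchy_inequality)
      have hol: "(\<lambda>z. L z - L 0) holomorphic_on ball 0 T" using L by (intro holomorphic_intros)
      show "(\<lambda>z. L z - L 0) holomorphic_on ball x (T / 4)"
        using sub hol ball_subset_cball by (blast intro: holomorphic_on_subset)
      show "continuous_on (cball x (T / 4)) (\<lambda>z. L z - L 0)"
        using sub hol by (blast intro: holomorphic_on_imp_continuous_on holomorphic_on_subset)
      fix y assume "norm (x - y) = T / 4"
      then have "norm y \<le> 3 / 4 * T" using norm_triangle_ineq2[of y x] that by (simp add: norm_minus_commute)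
      then show "norm (L y - L 0) \<le> 6 * (3 * M)" by (rule bound)
    qed (use T in auto)
    moreover have "L field_differentiable at x"
      using L(1) that T by (intro holomorphic_on_imp_differentiable_at[OF L(1)]) auto
    ultimately show ?thesis by (simp add: deriv_diff field_simps)
  qed
  have lip: "norm (L (z + w) - L z) \<le> 72 * M / T * norm (z + w - z)"
  proof (rule field_differentiable_bound[of "cball 0 (T / 2)" L "deriv L"])
    fix x :: complex assume "x \<in> cball 0 (T / 2)"
    then have "norm x \<le> T / 2" "x \<in> ball 0 T" using T by auto
    then show "norm (deriv L x) \<le> 72 * M / T"
      "(L has_field_derivative deriv L x) (at x within cball 0 (T / 2))"
      using deriv_bound holomorphic_derivI[OF L(1) open_ball]
      by (blast intro: has_field_derivative_at_within)+
  qed (use z in auto)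
  show ?thesis
  proof
    show "h (z + w) = h z * exp (L (z + w) - L z)"
      using L(2)[of z] L(2)[of "z + w"] h(2)[of z] z T by (simp add: exp_diff)
    show "norm (L (z + w) - L z) \<le> 72 * M / T * norm w" using lip by simp
  qed
qed

text \<open>With error bounds written as \<open>x - 1\<close>, the quantities \<open>x\<close>
  simply multiply, which suits long products.\<close>

lemma norm_mult_minus1_le:
  fixes a b :: complex
  assumes "norm (a - 1) \<le> x - 1" "norm (b - 1) \<le> y - 1"
  shows "norm (a * b - 1) \<le> x * y - 1"
proof -
  have "a * b - 1 = (a - 1) * (b - 1) + (a - 1) + (b - 1)" by (simp add: algebra_simps)
  also have "norm \<dots> \<le> norm (a - 1) * norm (b - 1) + norm (a - 1) + norm (b - 1)"
    by (metis (no_types, lifting) norm_mult norm_triangle_mono order_refl)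
  also have "\<dots> \<le> (x - 1) * (y - 1) + (x - 1) + (y - 1)"
    using assms order_trans[OF norm_ge_zero assms(1)] by (intro add_mono mult_mono) auto
  finally show ?thesis by (simp add: algebra_simps)
qed

lemma norm_prod_minus1_le:
  fixes f :: "'a \<Rightarrow> complex"
  assumes "\<And>i. i \<in> I \<Longrightarrow> norm (f i - 1) \<le> g i - 1"
  shows "norm ((\<Prod>i\<in>I. f i) - 1) \<le> (\<Prod>i\<in>I. g i) - 1"
  using assms by (induction I rule: infinite_finite_induct) (auto intro: norm_mult_minus1_le)

section \<open>Circles on which shifts act almost trivially\<close>

lemma harm_le_ln: "n > 0 \<Longrightarrow> harm n \<le> 1 + ln (real n)"
proof -
  assume "n > 0"
  then have "harm (Suc (n - 1)) - ln (real (Suc (n - 1))) \<le> harm (Suc 0) - ln (real (Suc 0))"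
    using decseqD[OF decseq_harm_diff_ln, of 0 "n - 1"] by (simp add: harm_def)
  with \<open>n > 0\<close> show ?thesis by (simp add: harm_def)
qed

text \<open>Replacing \<open>t\<close> by its floor \<open>i\<close> costs a factor 3. On each side
  of \<open>i\<close> the numbers |j - i| + 1 are distinct integers in
  \<open>{1..8 * J + 1}\<close>, so each side contributes at most three times the harmonic
  sum.\<close>

lemma sum_inverse_distance_le:
  assumes t: "0 \<le> t" "t \<le> real (8 * J)"
  shows "(\<Sum>j\<in>{2*J..<3*J}. 1 / max 1 \<bar>real j - t\<bar>) \<le> 6 * harm (8 * J + 1)"
proof -
  define i where "i = nat \<lfloor>t\<rfloor>"
  have i: "real i \<le> t" "t < real i + 1" "i \<le> 8 * J"
    using t unfolding i_def by linarith+
  have inj_bound: "(\<Sum>j\<in>A. 1 / real (d j)) \<le> harm (8 * J + 1)"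
    if "inj_on d A" "d ` A \<subseteq> {1..8 * J + 1}" for A and d :: "nat \<Rightarrow> nat"
  proof -
    have "(\<Sum>j\<in>A. 1 / real (d j)) = (\<Sum>k\<in>d ` A. inverse (real k))"
      using that(1) by (simp add: sum.reindex inverse_eq_divide)
    also have "\<dots> \<le> (\<Sum>k\<in>{1..8 * J + 1}. inverse (real k))"
      using that(2) by (intro sum_mono2) auto
    finally show ?thesis by (simp add: harm_def)
  qed
  let ?A = "{2*J..<3*J} \<inter> {i..}" and ?B = "{2*J..<3*J} \<inter> {..<i}"
  have far: "1 / max 1 \<bar>real j - t\<bar> \<le> 3 * (1 / x)" if "x > 0" "x \<le> \<bar>real j - real i\<bar> + 1" for j x
  proof -
    have "\<bar>real j - real i\<bar> \<le> \<bar>real j - t\<bar> + 1" using i by linarith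
    then have "x \<le> 3 * max 1 \<bar>real j - t\<bar>" using that by (simp add: max_def)
    with that show ?thesis by (simp add: field_simps)
  qed
  have "(\<Sum>j\<in>{2*J..<3*J}. 1 / max 1 \<bar>real j - t\<bar>) =
        (\<Sum>j\<in>?A. 1 / max 1 \<bar>real j - t\<bar>) + (\<Sum>j\<in>?B. 1 / max 1 \<bar>real j - t\<bar>)"
    by (subst sum.union_disjoint[symmetric]) (auto intro!: sum.cong)
  also have "(\<Sum>j\<in>?A. 1 / max 1 \<bar>real j - t\<bar>) \<le> (\<Sum>j\<in>?A. 3 * (1 / real (j - i + 1)))"
    by (intro sum_mono far) (auto simp: of_nat_diff)
  also have "\<dots> \<le> 3 * harm (8 * J + 1)"
    unfolding sum_distrib_left[symmetric]
    by (intro mult_left_mono inj_bound) (auto intro!: inj_onI)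
  also have "(\<Sum>j\<in>?B. 1 / max 1 \<bar>real j - t\<bar>) \<le> (\<Sum>j\<in>?B. 3 * (1 / real (i - j + 1)))"
    by (intro sum_mono far) (auto simp: of_nat_diff)
  also have "\<dots> \<le> 3 * harm (8 * J + 1)"
    unfolding sum_distrib_left[symmetric]
    using i(3) by (intro mult_left_mono inj_bound) (auto intro!: inj_onI)
  finally show ?thesis by simp
qed

text \<open>Averaging over the \<open>J\<close> candidate radii: after swapping the sums, some
  radius is no worse than the mean. In the application \<open>t x\<close> runs through the moduli of
  zeros.\<close>

lemma good_radius_exists:
  assumes X: "finite X" "\<And>x. x \<in> X \<Longrightarrow> 0 \<le> t x \<and> t x \<le> real (8 * J)" and J: "J > 0"
  obtains j where "j \<in> {2*J..<3*J}"
    "(\<Sum>x\<in>X. 1 / max 1 \<bar>real j - t x\<bar>) \<le> 6 * real (card X) * harm (8 * J + 1) / real J"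
proof (rule ccontr)
  assume "\<not> thesis"
  then have "\<And>j. j \<in> {2*J..<3*J} \<Longrightarrow>
      6 * real (card X) * harm (8 * J + 1) / real J < (\<Sum>x\<in>X. 1 / max 1 \<bar>real j - t x\<bar>)"
    using that not_le by blast
  then have "(\<Sum>j\<in>{2*J..<3*J}. 6 * real (card X) * harm (8 * J + 1) / real J) <
      (\<Sum>j\<in>{2*J..<3*J}. \<Sum>x\<in>X. 1 / max 1 \<bar>real j - t x\<bar>)"
    using J by (intro sum_strict_mono) auto
  also have "\<dots> = (\<Sum>x\<in>X. \<Sum>j\<in>{2*J..<3*J}. 1 / max 1 \<bar>real j - t x\<bar>)"
    by (rule sum.swap)
  also have "\<dots> \<le> (\<Sum>x\<in>X. 6 * harm (8 * J + 1))"
    using X by (intro sum_mono sum_inverse_distance_le) auto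
  finally show False using J by (simp add: field_simps)
qed

text \<open>A shift by \<open>w\<close> multiplies each linear factor by
  \<open>1 + w / (z - a k)\<close> and the zero-free factor by \<open>exp u\<close>. The two effects
  are controlled by \<open>exp \<delta>\<close> and \<open>exp (2 * \<delta>)\<close>, which combine
  to \<open>exp (3 * \<delta>)\<close>.\<close>

lemma shift_estimate:
  fixes a :: "nat \<Rightarrow> complex"
  assumes f: "\<And>z. f z = (\<Prod>k<N. 1 - z / a k) * h z" and a: "\<And>k. k < N \<Longrightarrow> a k \<noteq> 0"
    and ne: "\<And>k. k < N \<Longrightarrow> z \<noteq> a k" and S: "(\<Sum>k<N. norm (w / (z - a k))) \<le> \<delta>"
    and h: "h (z + w) = h z * exp u" and u: "norm u \<le> \<delta>" and \<delta>: "\<delta> \<le> 1 / 2"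
  shows "norm (f (z + w) - f z) \<le> (exp (3 * \<delta>) - 1) * norm (f z)"
proof -
  have "0 \<le> \<delta>" using u norm_ge_zero order_trans by blast
  have "1 - (z + w) / a k = (1 - z / a k) * (1 + w / (z - a k))" if "k < N" for k
    using a[OF that] ne[OF that] by (simp add: field_simps)
  then have eq: "f (z + w) = f z * ((\<Prod>k<N. 1 + w / (z - a k)) * exp u)"
    unfolding f h by (simp add: prod.distrib mult_ac)
  have "norm ((\<Prod>k<N. 1 + w / (z - a k)) * exp u - 1) \<le> exp \<delta> * exp (2 * \<delta>) - 1"
  proof (rule norm_mult_minus1_le)
    have "norm ((\<Prod>k<N. 1 + w / (z - a k)) - 1) \<le> (\<Prod>k<N. 1 + norm (w / (z - a k))) - 1"
      by (rule norm_prod_minus1_le_prod_minus1)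
    also have "(\<Prod>k<N. 1 + norm (w / (z - a k))) \<le> exp (\<Sum>k<N. norm (w / (z - a k)))"
      by (rule prod_le_exp_sum) auto
    also have "\<dots> \<le> exp \<delta>" using S by simp
    finally show "norm ((\<Prod>k<N. 1 + w / (z - a k)) - 1) \<le> exp \<delta> - 1" by simp
    have "norm (exp u - 1) \<le> 3 / 2 * norm u"
      using u \<delta> by (intro norm_exp_bounds) auto
    also have "\<dots> \<le> 2 * \<delta>" using u \<open>0 \<le> \<delta>\<close> by linarith
    also have "\<dots> \<le> exp (2 * \<delta>) - 1" using exp_ge_add_one_self[of "2 * \<delta>"] by linarith
    finally show "norm (exp u - 1) \<le> exp (2 * \<delta>) - 1" .
  qed
  also have "exp \<delta> * exp (2 * \<delta>) = exp (3 * \<delta>)" by (simp flip: exp_add)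
  finally have "norm (f z) * norm ((\<Prod>k<N. 1 + w / (z - a k)) * exp u - 1) \<le> norm (f z) * (exp (3 * \<delta>) - 1)"
    by (intro mult_left_mono) auto
  moreover have "f (z + w) - f z = f z * ((\<Prod>k<N. 1 + w / (z - a k)) * exp u - 1)"
    unfolding eq by (simp add: algebra_simps)
  ultimately show ?thesis by (simp add: norm_mult mult_ac)
qed

text \<open>Here order less than 1 is decisive: a zero count of size J^rho times a logarithm is
  negligible against the radius.\<close>

lemma power_growth_tendsto:
  fixes C c \<rho> :: real
  assumes "0 < \<rho>" "\<rho> < 1"
  shows "(\<lambda>J. (C * (1 + 24 * real J) powr \<rho> + c) * (1 + ln (8 * real J + 1)) / real J) \<longlonglongrightarrow> 0"
  using assms by real_asymp

text \<open>At scale \<open>J\<close>, split off the zeros in the disc of radius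
  \<open>T = 8 * J\<close>. Their number is O(J^rho) with rho < 1, so averaging finds a radius
  between \<open>2 * J\<close> and \<open>3 * J\<close> with small total inverse distance to them;
  the zero-free factors barely react to bounded shifts.\<close>

lemma good_circles_at_0:
  assumes I: "finite I" "\<And>i. i \<in> I \<Longrightarrow> small_growth (f i)" "\<And>i. i \<in> I \<Longrightarrow> f i 0 \<noteq> 0"
    and \<epsilon>: "\<epsilon> > 0"
  obtains r where "r > R"
    "\<And>i z w. i \<in> I \<Longrightarrow> norm z = r \<Longrightarrow> norm w \<le> K \<Longrightarrow>
       f i z \<noteq> 0 \<and> norm (f i (z + w) - f i z) \<le> \<epsilon> * norm (f i z)"
proof -
  \<comment> \<open>As \<open>K' \<ge> 1\<close>, a quotient \<open>K' / max 1 d\<close> below 1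
    forces \<open>d > 1\<close>; so the truncation in \<open>max 1\<close> is inactive on the chosen
    circle, which misses every zero.\<close>
  define K' where "K' = max K 1"
  define \<delta> where "\<delta> = min (1 / 2) (ln (1 + \<epsilon>) / 3)"
  have \<delta>: "0 < \<delta>" "\<delta> \<le> 1 / 2" "exp (3 * \<delta>) - 1 \<le> \<epsilon>"
  proof -
    have "exp (3 * \<delta>) \<le> exp (ln (1 + \<epsilon>))" by (subst exp_le_cancel_iff) (simp add: \<delta>_def)
    then show "exp (3 * \<delta>) - 1 \<le> \<epsilon>" using \<epsilon> by simp
  qed (use \<epsilon> in \<open>auto simp: \<delta>_def\<close>)
  have "\<forall>i\<in>I. \<exists>\<rho> C. 0 < \<rho> \<and> \<rho> < 1 \<and> 0 \<le> C \<and> (\<forall>z. norm (f i z) \<le> exp (C * (1 + norm z) powr \<rho>))"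
    using I(2) unfolding small_growth_def by blast
  then obtain \<rho> C where \<rho>: "\<And>i. i \<in> I \<Longrightarrow> 0 < \<rho> i" "\<And>i. i \<in> I \<Longrightarrow> \<rho> i < 1"
      and C: "\<And>i. i \<in> I \<Longrightarrow> 0 \<le> C i" "\<And>i z. i \<in> I \<Longrightarrow> norm (f i z) \<le> exp (C i * (1 + norm z) powr \<rho> i)"
    by metis
  \<comment> \<open>\<open>24 * J\<close> is \<open>3 * T\<close>, the radius of the circle on which
    \<open>f i\<close> is bounded. The added constant yields both \<open>M i J > 0\<close> and
    \<open>exp (- M i J) \<le> norm (f i 0)\<close>.\<close>
  define M where "M = (\<lambda>i J. C i * (1 + 24 * real J) powr \<rho> i + (\<bar>ln (norm (f i 0))\<bar> + 1))"
  have M_pos: "0 < M i J" if "i \<in> I" for i J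
    using C(1)[OF that] by (auto simp: M_def intro!: add_nonneg_pos)
  have lim: "(\<lambda>J. M i J * (1 + ln (8 * real J + 1)) / real J) \<longlonglongrightarrow> 0" if "i \<in> I" for i
    unfolding M_def using \<rho>[OF that] by (rule power_growth_tendsto)
  \<comment> \<open>The constant 24 is 6 from the averaging times 4 from the zero count
    \<open>N i \<le> 4 * M i J\<close>; it also covers the 72 / 8 = 9 from the zero-free
    part.\<close>
  have "(\<lambda>J. 24 * K' * (\<Sum>i\<in>I. M i J * (1 + ln (8 * real J + 1)) / real J)) \<longlonglongrightarrow> 24 * K' * (\<Sum>i\<in>I. 0)"
    by (intro tendsto_intros lim)
  then have "eventually (\<lambda>J. 24 * K' * (\<Sum>i\<in>I. M i J * (1 + ln (8 * real J + 1)) / real J) < \<delta>) sequentially"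
    using \<delta>(1) by (intro order_tendstoD) auto
  moreover have "eventually (\<lambda>J. \<bar>R\<bar> < real J) sequentially" "eventually (\<lambda>J. K' < real J) sequentially"
    using filterlim_real_sequentially by (simp_all add: filterlim_at_top_dense)
  ultimately have "eventually (\<lambda>J. 24 * K' * (\<Sum>i\<in>I. M i J * (1 + ln (8 * real J + 1)) / real J) < \<delta> \<and>
      \<bar>R\<bar> < real J \<and> K' < real J) sequentially"
    by (intro eventually_conj)
  then obtain J where J: "24 * K' * (\<Sum>i\<in>I. M i J * (1 + ln (8 * real J + 1)) / real J) < \<delta>"
      "real J > \<bar>R\<bar>" "real J > K'"
    using eventually_happens'[OF sequentially_bot] by blast
  define T where "T = 8 * real J"
  have K': "K' \<ge> 1" "K' \<ge> K" by (auto simp: K'_def)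
  have "J > 0" "T > 0" using J(3) K' by (auto simp: T_def)
  define fac where "fac = (\<lambda>i (N::nat) a h. entire h \<and> (\<forall>z. f i z = (\<Prod>k<N. 1 - z / a k) * h z) \<and>
      (\<forall>k<N. a k \<noteq> 0 \<and> norm (a k) \<le> T) \<and> (\<forall>z. norm z \<le> T \<longrightarrow> h z \<noteq> 0) \<and>
      2 ^ N * norm (f i 0) \<le> exp (M i J) \<and> (\<forall>z. norm z \<le> 3 * T \<longrightarrow> norm (h z) \<le> exp (M i J)))"
  have "\<forall>i\<in>I. \<exists>N a h. fac i N a h"
  proof
    fix i assume i: "i \<in> I"
    have "norm (f i z) \<le> exp (M i J)" if "norm z = 3 * T" for z
      by (rule order_trans[OF C(2)[OF i, of z]]) (simp add: M_def T_def that)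
    from small_growth_entire[OF I(2)[OF i]] I(3)[OF i] \<open>T > 0\<close> this
    show "\<exists>N a h. fac i N a h"
    proof (rule factor_out_zeros)
      fix N :: nat and a h
      assume "entire h" "\<And>z. f i z = (\<Prod>k<N. 1 - z / a k) * h z"
        "\<And>k. k < N \<Longrightarrow> a k \<noteq> 0 \<and> norm (a k) \<le> T" "\<And>z. norm z \<le> T \<Longrightarrow> h z \<noteq> 0"
        "2 ^ N * norm (f i 0) \<le> exp (M i J)" "\<And>z. norm z \<le> 3 * T \<Longrightarrow> norm (h z) \<le> exp (M i J)"
      then show ?thesis
        unfolding fac_def by (intro exI[of _ N] exI[of _ a] exI[of _ h]) blast
    qed
  qed
  then obtain N a h where "\<And>i. i \<in> I \<Longrightarrow> fac i (N i) (a i) (h i)"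
    by metis
  then have h: "\<And>i. i \<in> I \<Longrightarrow> entire (h i)"
      and f: "\<And>i z. i \<in> I \<Longrightarrow> f i z = (\<Prod>k<N i. 1 - z / a i k) * h i z"
      and a: "\<And>i k. i \<in> I \<Longrightarrow> k < N i \<Longrightarrow> a i k \<noteq> 0 \<and> norm (a i k) \<le> T"
      and h_ne: "\<And>i z. i \<in> I \<Longrightarrow> norm z \<le> T \<Longrightarrow> h i z \<noteq> 0"
      and N: "\<And>i. i \<in> I \<Longrightarrow> 2 ^ N i * norm (f i 0) \<le> exp (M i J)"
      and h_le: "\<And>i z. i \<in> I \<Longrightarrow> norm z \<le> 3 * T \<Longrightarrow> norm (h i z) \<le> exp (M i J)"
    unfolding fac_def by blast+
  have f0: "exp (- M i J) \<le> norm (f i 0)" if i: "i \<in> I" for i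
  proof -
    have "0 \<le> C i * (1 + 24 * real J) powr \<rho> i" using C(1)[OF i] by simp
    then have "- M i J \<le> ln (norm (f i 0))" unfolding M_def by linarith
    then have "exp (- M i J) \<le> exp (ln (norm (f i 0)))" by simp
    then show ?thesis using I(3)[OF i] by simp
  qed
  have N_le: "real (N i) \<le> 4 * M i J" if i: "i \<in> I" for i
  proof -
    have "2 ^ N i * exp (- M i J) \<le> exp (M i J)"
      using N[OF i] f0[OF i] by (meson mult_left_mono order_trans zero_le_numeral zero_le_power)
    then have "2 ^ N i \<le> exp (M i J) * exp (M i J)"
      by (simp add: exp_minus field_simps)
    then have "exp (real (N i) * ln 2) \<le> exp (M i J + M i J)"
      unfolding exp_add exp_of_nat_mult by simp
    then have "real (N i) * ln 2 \<le> 2 * M i J" by simp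
    moreover have "real (N i) * (1 / 2) \<le> real (N i) * ln 2"
      using ln2_ge_two_thirds by (intro mult_left_mono) auto
    ultimately show ?thesis by simp
  qed
  \<comment> \<open>The split-off zeros of all functions, indexed with multiplicity, so that one
    radius serves every \<open>f i\<close>.\<close>
  define X where "X = Sigma I (\<lambda>i. {..<N i})"
  have X: "finite X" unfolding X_def using I(1) by auto
  obtain j where j: "j \<in> {2*J..<3*J}" and j_sum:
      "(\<Sum>x\<in>X. 1 / max 1 \<bar>real j - norm (a (fst x) (snd x))\<bar>) \<le> 6 * real (card X) * harm (8 * J + 1) / real J"
  proof (rule good_radius_exists[OF X, of "\<lambda>x. norm (a (fst x) (snd x))" J])
    show "0 \<le> norm (a (fst x) (snd x)) \<and> norm (a (fst x) (snd x)) \<le> real (8 * J)" if "x \<in> X" for x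
      using a that by (auto simp: X_def T_def)
  qed (use \<open>J > 0\<close> that in auto)
  have "K' * (\<Sum>x\<in>X. 1 / max 1 \<bar>real j - norm (a (fst x) (snd x))\<bar>) \<le> \<delta>"
  proof -
    have "real (card X) = (\<Sum>i\<in>I. real (N i))"
      unfolding X_def using I(1) by simp
    also have "\<dots> \<le> (\<Sum>i\<in>I. 4 * M i J)" by (intro sum_mono N_le)
    finally have card: "real (card X) \<le> (\<Sum>i\<in>I. 4 * M i J)" .
    have harm: "harm (8 * J + 1) \<le> 1 + ln (8 * real J + 1)"
      using harm_le_ln[of "8 * J + 1"] by (simp add: add.commute)
    have "6 * real (card X) * harm (8 * J + 1) / real J
        \<le> 6 * (\<Sum>i\<in>I. 4 * M i J) * (1 + ln (8 * real J + 1)) / real J"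
      using card harm by (intro divide_right_mono mult_mono) (auto intro: harm_nonneg sum_nonneg order_trans[OF of_nat_0_le_iff card])
    also have "\<dots> = 24 * (\<Sum>i\<in>I. M i J * (1 + ln (8 * real J + 1)) / real J)"
      by (simp add: sum_distrib_left sum_distrib_right sum_divide_distrib mult_ac)
    finally have "K' * (\<Sum>x\<in>X. 1 / max 1 \<bar>real j - norm (a (fst x) (snd x))\<bar>)
        \<le> K' * (24 * (\<Sum>i\<in>I. M i J * (1 + ln (8 * real J + 1)) / real J))"
      using j_sum K' by (intro mult_left_mono) auto
    then show ?thesis using J(1) by (simp add: mult_ac)
  qed
  then have sum_le: "(\<Sum>x\<in>X. K' / max 1 \<bar>real j - norm (a (fst x) (snd x))\<bar>) \<le> \<delta>"
    by (simp add: sum_distrib_left)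
  show ?thesis
  proof
    show "real j > R" using j J by auto
    fix i and z w :: complex assume i: "i \<in> I" and z: "norm z = real j" and w: "norm w \<le> K"
    have far: "norm (w / (z - a i k)) \<le> K' / max 1 \<bar>real j - norm (a i k)\<bar> \<and> z \<noteq> a i k"
      if k: "k < N i" for k
    proof -
      have "K' / max 1 \<bar>real j - norm (a i k)\<bar> \<le> \<delta>"
        using member_le_sum[of "(i, k)" X "\<lambda>x. K' / max 1 \<bar>real j - norm (a (fst x) (snd x))\<bar>"] sum_le i k X K'
        by (auto simp: X_def)
      then have "K' / max 1 \<bar>real j - norm (a i k)\<bar> < 1" using \<delta>(2) by linarith
      then have "K' < max 1 \<bar>real j - norm (a i k)\<bar>" by (simp add: field_simps)
      then have gt: "1 < \<bar>real j - norm (a i k)\<bar>" using K' by linarith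
      moreover have "\<bar>real j - norm (a i k)\<bar> \<le> norm (z - a i k)"
        using norm_triangle_ineq3[of z "a i k"] z by simp
      ultimately have le: "max 1 \<bar>real j - norm (a i k)\<bar> \<le> norm (z - a i k)" by simp
      then have "norm w / norm (z - a i k) \<le> K' / max 1 \<bar>real j - norm (a i k)\<bar>"
        using w K' by (intro frac_le) auto
      then show ?thesis using le by (auto simp: norm_divide)
    qed
    have "(\<Sum>k<N i. norm (w / (z - a i k))) \<le> (\<Sum>k<N i. K' / max 1 \<bar>real j - norm (a i k)\<bar>)"
      using far by (intro sum_mono) auto
    also have "\<dots> = (\<Sum>x\<in>Pair i ` {..<N i}. K' / max 1 \<bar>real j - norm (a (fst x) (snd x))\<bar>)"
      by (subst sum.reindex) (auto intro: inj_onI)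
    also have "\<dots> \<le> (\<Sum>x\<in>X. K' / max 1 \<bar>real j - norm (a (fst x) (snd x))\<bar>)"
      using X i K' by (intro sum_mono2) (auto simp: X_def)
    finally have S: "(\<Sum>k<N i. norm (w / (z - a i k))) \<le> \<delta>" using sum_le by linarith
    \<comment> \<open>The radius is below \<open>3 * J\<close> and the shift below \<open>J\<close>,
      so both points stay within \<open>4 * J = T / 2\<close>.\<close>
    have zT: "norm z \<le> T / 2" "norm (z + w) \<le> T / 2"
      using norm_triangle_ineq[of z w] z w j J K' by (auto simp: T_def)
    obtain u where u: "h i (z + w) = h i z * exp u" "norm u \<le> 72 * M i J / T * norm w"
    proof (rule zero_free_shift[of "h i" T "M i J" z w])
      show "norm (h i x) \<le> exp (M i J)" if "norm x \<le> T" for x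
        using h_le[OF i, of x] that \<open>T > 0\<close> by simp
      show "exp (- M i J) \<le> norm (h i 0)" using f[OF i, of 0] f0[OF i] by simp
    qed (use h_ne i M_pos \<open>T > 0\<close> h zT that in auto)
    have "norm u \<le> 72 * M i J / T * K'"
      using u(2) w K' M_pos[OF i] \<open>T > 0\<close>
      by (smt (verit) divide_nonneg_pos mult_left_mono)
    also have "\<dots> = 9 * K' * (M i J * 1 / real J)" by (simp add: T_def)
    also have "\<dots> \<le> 24 * K' * (M i J * (1 + ln (8 * real J + 1)) / real J)"
      using K' less_imp_le[OF M_pos[OF i]] by (intro mult_mono divide_right_mono) auto
    also have "\<dots> \<le> 24 * K' * (\<Sum>i\<in>I. M i J * (1 + ln (8 * real J + 1)) / real J)"
      using K' I(1) i M_pos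
      by (intro mult_left_mono member_le_sum[where f = "\<lambda>i. M i J * (1 + ln (8 * real J + 1)) / real J"])
         (auto simp: less_imp_le)
    finally have u_le: "norm u \<le> \<delta>" using J(1) by linarith
    have "norm (f i (z + w) - f i z) \<le> (exp (3 * \<delta>) - 1) * norm (f i z)"
      using a[OF i] far by (intro shift_estimate[OF f[OF i] _ _ S u(1) u_le \<delta>(2)]) auto
    also have "\<dots> \<le> \<epsilon> * norm (f i z)" using \<delta>(3) by (intro mult_right_mono) auto
    finally show "f i z \<noteq> 0 \<and> norm (f i (z + w) - f i z) \<le> \<epsilon> * norm (f i z)"
      using far a[OF i] h_ne[OF i, of z] zT(1) \<open>T > 0\<close> by (auto simp: f[OF i])
  qed
qed

lemma good_circles:
  assumes I: "finite I" "\<And>i. i \<in> I \<Longrightarrow> small_growth (f i)" "\<And>i. i \<in> I \<Longrightarrow> f i b \<noteq> 0"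
    and \<epsilon>: "\<epsilon> > 0"
  obtains r where "r > R"
    "\<And>i z w. i \<in> I \<Longrightarrow> norm (z - b) = r \<Longrightarrow> norm w \<le> K \<Longrightarrow>
       f i z \<noteq> 0 \<and> norm (f i (z + w) - f i z) \<le> \<epsilon> * norm (f i z)"
proof -
  obtain r where r: "r > R"
    "\<And>i z w. i \<in> I \<Longrightarrow> norm z = r \<Longrightarrow> norm w \<le> K \<Longrightarrow>
       f i (z + b) \<noteq> 0 \<and> norm (f i (z + w + b) - f i (z + b)) \<le> \<epsilon> * norm (f i (z + b))"
  proof (rule good_circles_at_0[of I "\<lambda>i z. f i (z + b)" \<epsilon> R K])
    show "small_growth (\<lambda>z. f i (z + b))" if "i \<in> I" for i
      by (rule small_growth_shift[OF I(2)[OF that]])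
  qed (use assms that in auto)
  show ?thesis
    by (rule that[OF r(1)]) (use r(2)[of _ "z - b" for z] in \<open>auto simp: algebra_simps\<close>)
qed

section \<open>Casoratians\<close>

text \<open>A good circle centred where \<open>D\<close> is nonzero and enclosing the start of the
  ray must be crossed. The first ray point outside lies within distance 1 of the circle, where such
  a shift alters \<open>D\<close> by at most half its nonzero value, so \<open>D\<close> cannot
  vanish there.\<close>

lemma small_growth_eq_0_if_zero_on_ray:
  assumes D: "small_growth D" and zero: "\<And>k::nat. D (z\<^sub>0 + of_nat k) = 0"
  shows "D z = 0"
proof (rule ccontr)
  assume "D z \<noteq> 0"
  obtain r where r: "r > norm (z\<^sub>0 - z)"
    "\<And>x w. norm (x - z) = r \<Longrightarrow> norm w \<le> 1 \<Longrightarrow> D x \<noteq> 0 \<and> norm (D (x + w) - D x) \<le> 1 / 2 * norm (D x)"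
    using good_circles[of "{()}" "\<lambda>_. D" z "1/2" "norm (z\<^sub>0 - z)" 1] D \<open>D z \<noteq> 0\<close> by auto
  have "r > 0" using r(1) norm_ge_zero le_less_trans by blast
  define P where "P k \<longleftrightarrow> r < norm (z\<^sub>0 + of_nat k - z)" for k :: nat
  obtain n :: nat where n: "r + norm (z\<^sub>0 - z) < real n"
    using reals_Archimedean2 by blast
  have "P n"
    using norm_triangle_ineq2[of "of_nat n" "z - z\<^sub>0"] n
    by (simp add: P_def algebra_simps norm_minus_commute)
  define k where "k = (LEAST k. P k)"
  have k: "P k" unfolding k_def using \<open>P n\<close> by (rule LeastI)
  have "\<not> P 0" using r(1) by (simp add: P_def)
  then have "k \<noteq> 0" using k by metis
  then have "\<not> P (k - 1)" unfolding k_def by (intro not_less_Least) simp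
  define y where "y = z\<^sub>0 + of_nat k - z"
  have "norm (y - 1) \<le> r"
    using \<open>\<not> P (k - 1)\<close> \<open>k \<noteq> 0\<close> by (simp add: P_def y_def of_nat_diff algebra_simps)
  then have y: "r < norm y" "norm y \<le> r + 1"
    using k norm_triangle_ineq[of "y - 1" 1] by (auto simp: P_def y_def)
  have "y \<noteq> 0" using y(1) \<open>r > 0\<close> by force
  \<comment> \<open>Radial projection of the first outside point onto the circle.\<close>
  define q where "q = of_real (r / norm y) * y"
  have q: "norm q = r" using \<open>y \<noteq> 0\<close> \<open>r > 0\<close> by (simp add: q_def norm_mult norm_divide)
  have "y - q = of_real (1 - r / norm y) * y" by (simp add: q_def algebra_simps)
  then have "norm (y - q) = \<bar>1 - r / norm y\<bar> * norm y" by (simp only: norm_mult norm_of_real)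
  also have "\<dots> = norm y - r" using y \<open>r > 0\<close> by (auto simp: field_simps abs_if)
  finally have yq: "norm (y - q) \<le> 1" using y by simp
  have "D (z + q) \<noteq> 0 \<and> norm (D (z + q + (y - q)) - D (z + q)) \<le> 1 / 2 * norm (D (z + q))"
    using q yq by (intro r(2)) auto
  moreover have "D (z + q + (y - q)) = 0" using zero[of k] by (simp add: y_def)
  ultimately show False by simp
qed

text \<open>Along an orbit \<open>z\<^sub>0 + k\<close> avoiding the zeros of \<open>B\<close> the
  quotient \<open>A / B\<close> is constant, so \<open>A - c * B\<close> vanishes on a ray. The
  equation is asked only where \<open>B (z + 1) \<noteq> 0\<close> because in the Casoratian
  argument it comes from a matrix invertible at \<open>z + 1\<close>.\<close>

lemma small_growth_periodic_quotient:
  assumes A: "small_growth A" and B: "small_growth B" and "\<exists>z. B z \<noteq> 0"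
    and eq: "\<And>z. B (z + 1) \<noteq> 0 \<Longrightarrow> A (z + 1) * B z = A z * B (z + 1)"
  obtains c where "\<And>z. A z = c * B z"
proof -
  have "\<exists>z\<^sub>0. \<forall>k\<in>(UNIV::nat set). B (z\<^sub>0 + of_nat k) \<noteq> 0"
  proof (rule entire_common_nonzero)
    fix k :: nat
    show "entire (\<lambda>z. B (z + of_nat k))" by (intro small_growth_entire small_growth_shift B)
    show "\<exists>w. B (w + of_nat k) \<noteq> 0" using assms(3) by (metis diff_add_cancel)
  qed simp
  then obtain z\<^sub>0 where z0: "\<And>k::nat. B (z\<^sub>0 + of_nat k) \<noteq> 0" by auto
  define c where "c = A z\<^sub>0 / B z\<^sub>0"
  have "A (z\<^sub>0 + of_nat k) = c * B (z\<^sub>0 + of_nat k)" for k :: nat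
  proof (induction k)
    case 0
    then show ?case using z0[of 0] by (simp add: c_def)
  next
    case (Suc k)
    have "A (z\<^sub>0 + of_nat (Suc k)) * B (z\<^sub>0 + of_nat k) = A (z\<^sub>0 + of_nat k) * B (z\<^sub>0 + of_nat (Suc k))"
      using eq[of "z\<^sub>0 + of_nat k"] z0[of "Suc k"] by (simp add: algebra_simps)
    then show ?case using Suc z0[of k] by (simp add: mult_ac)
  qed
  then have zero: "A (z\<^sub>0 + of_nat k) - c * B (z\<^sub>0 + of_nat k) = 0" for k :: nat by simp
  have growth: "small_growth (\<lambda>z. A z - c * B z)"
    by (rule small_growth_diff[OF A small_growth_cmult[OF B]])
  show ?thesis
  proof (rule that)
    fix z
    have "A z - c * B z = 0"
      by (rule small_growth_eq_0_if_zero_on_ray[OF growth zero])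
    then show "A z = c * B z" by simp
  qed
qed

section \<open>Casoratian determinants and linear dependence\<close>

definition casoratian :: "(nat \<Rightarrow> complex \<Rightarrow> complex) \<Rightarrow> nat \<Rightarrow> complex \<Rightarrow> complex" where
  "casoratian u s z = Determinant.det (Matrix.mat s s (\<lambda>(i, j). u i (z + of_nat j)))"

lemma permutes_less: "p permutes {0..<s} \<Longrightarrow> i < s \<Longrightarrow> p i < (s :: nat)"
  using permutes_in_image[of p "{0..<s}" i] by simp

lemma det_mat_Leibniz:
  "Determinant.det (Matrix.mat s s F) =
     (\<Sum>p | p permutes {0..<s}. signof p * (\<Prod>i=0..<s. F (i, p i)))"
  by (subst det_def'[of _ s]) (simp_all add: permutes_less)

lemma small_growth_det:
  fixes F :: "nat \<Rightarrow> nat \<Rightarrow> complex \<Rightarrow> complex"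
  assumes "\<And>i j. i < s \<Longrightarrow> j < s \<Longrightarrow> small_growth (F i j)"
  shows "small_growth (\<lambda>z. Determinant.det (Matrix.mat s s (\<lambda>(i, j). F i j z)))"
  unfolding det_mat_Leibniz prod.case
  by (intro small_growth_sum small_growth_cmult small_growth_prod assms) (simp_all add: permutes_less)

lemma det_mat_scale_rows:
  "Determinant.det (Matrix.mat s s (\<lambda>(i, j). c i * F i j)) =
     (\<Prod>i<s. c i) * Determinant.det (Matrix.mat s s (\<lambda>(i, j). F i j))"
  unfolding det_mat_Leibniz prod.case prod.distrib sum_distrib_left atLeast0LessThan
  by (intro sum.cong refl) (rule mult.left_commute)

lemma casoratian_0 [simp]: "casoratian u 0 z = 1"
  by (simp add: casoratian_def)

lemma small_growth_casoratian:
  "(\<And>i. i < s \<Longrightarrow> small_growth (u i)) \<Longrightarrow> small_growth (casoratian u s)"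
  unfolding casoratian_def[abs_def] by (intro small_growth_det small_growth_shift)

text \<open>Expand linearly in row \<open>l\<close>; every term with \<open>k \<noteq> l\<close> has
  two equal rows. This lets the right-hand side of the functional equation replace any
  summand.\<close>

lemma casoratian_sum_row:
  assumes "l < s"
  shows "casoratian (u(l := \<lambda>z. \<Sum>i<s. u i z)) s z = casoratian u s z"
proof -
  let ?M = "\<lambda>u. Matrix.mat s s (\<lambda>(i, j). u i (z + of_nat j))"
  have "casoratian (u(l := \<lambda>z. \<Sum>i<s. u i z)) s z = (\<Sum>k<s. casoratian (u(l := u k)) s z)"
    unfolding casoratian_def det_mat_Leibniz
  proof (subst sum.swap, rule sum.cong[OF refl])
    fix p assume "p \<in> {p. p permutes {0..<s}}"
    have split: "(\<Prod>i=0..<s. (u(l := g)) i (z + of_nat (p i))) =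
        g (z + of_nat (p l)) * (\<Prod>i\<in>{0..<s} - {l}. u i (z + of_nat (p i)))" for g
    proof -
      have "(\<Prod>i=0..<s. (u(l := g)) i (z + of_nat (p i))) =
        (u(l := g)) l (z + of_nat (p l)) * (\<Prod>i\<in>{0..<s} - {l}. (u(l := g)) i (z + of_nat (p i)))"
        using assms by (intro prod.remove) auto
      also have "(\<Prod>i\<in>{0..<s} - {l}. (u(l := g)) i (z + of_nat (p i))) =
          (\<Prod>i\<in>{0..<s} - {l}. u i (z + of_nat (p i)))"
        by (intro prod.cong) auto
      finally show ?thesis by simp
    qed
    show "signof p * (\<Prod>i = 0..<s. case (i, p i) of (i, j) \<Rightarrow> (u(l := \<lambda>z. \<Sum>i<s. u i z)) i (z + of_nat j)) =
      (\<Sum>k<s. signof p * (\<Prod>i = 0..<s. case (i, p i) of (i, j) \<Rightarrow> (u(l := u k)) i (z + of_nat j)))"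
      by (simp only: prod.case split sum_distrib_left sum_distrib_right)
  qed
  also have "\<dots> = (\<Sum>k<s. if k = l then casoratian u s z else 0)"
  proof (intro sum.cong refl)
    fix k assume k: "k \<in> {..<s}"
    show "casoratian (u(l := u k)) s z = (if k = l then casoratian u s z else 0)"
    proof (cases "k = l")
      case False
      then have "Determinant.det (?M (u(l := u k))) = 0"
        using k assms by (intro det_identical_rows[of _ s l k]) (auto intro!: eq_vecI)
      with False show ?thesis by (simp add: casoratian_def)
    qed simp
  qed
  also have "\<dots> = casoratian u s z" using assms by simp
  finally show ?thesis .
qed

text \<open>With at least two rows the all-ones determinant is 0; subtracting it termwise from the
  Leibniz formula leaves products minus 1.\<close>

lemma det_near_ones_le:
  fixes q :: "nat \<Rightarrow> nat \<Rightarrow> complex"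
  assumes s: "s \<ge> 2" and q: "\<And>i j. i < s \<Longrightarrow> j < s \<Longrightarrow> norm (q i j - 1) \<le> \<eta> - 1"
  shows "norm (Determinant.det (Matrix.mat s s (\<lambda>(i, j). q i j))) \<le> fact s * (\<eta> ^ s - 1)"
proof -
  let ?S = "{p. p permutes {0..<s}}"
  have "Determinant.det (Matrix.mat s s (\<lambda>(i, j). 1 :: complex)) = 0"
    using s by (intro det_identical_rows[of _ s 0 1]) (auto intro!: eq_vecI)
  then have zero: "(\<Sum>p\<in>?S. signof p * 1 :: complex) = 0"
    by (simp add: det_mat_Leibniz)
  have "Determinant.det (Matrix.mat s s (\<lambda>(i, j). q i j)) =
      (\<Sum>p\<in>?S. signof p * (\<Prod>i=0..<s. q i (p i))) - (\<Sum>p\<in>?S. signof p * 1)"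
    by (simp only: zero diff_zero det_mat_Leibniz prod.case)
  also have "\<dots> = (\<Sum>p\<in>?S. signof p * ((\<Prod>i=0..<s. q i (p i)) - 1))"
    by (simp only: sum_subtractf[symmetric] right_diff_distrib)
  also have "norm \<dots> \<le> (\<Sum>p\<in>?S. \<eta> ^ s - 1)"
  proof (rule sum_norm_le)
    fix p assume p: "p \<in> ?S"
    have "norm ((\<Prod>i=0..<s. q i (p i)) - 1) \<le> (\<Prod>i=0..<s. \<eta>) - 1"
      using p by (intro norm_prod_minus1_le q) (auto dest: permutes_less)
    moreover have "norm (signof p :: complex) = 1" by (simp add: sign_def)
    ultimately show "norm (signof p * ((\<Prod>i=0..<s. q i (p i)) - 1)) \<le> \<eta> ^ s - 1"
      by (simp add: norm_mult)
  qed
  also have "\<dots> = fact s * (\<eta> ^ s - 1)"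
    using card_permutations[of "{0..<s}" s] by simp
  finally show ?thesis .
qed

text \<open>Induction on \<open>s\<close>. If the smaller Casoratian vanishes identically, its
  relation extends by 0. Otherwise the cofactors of the last column annihilate all columns, and
  their ratios to the last cofactor are 1-periodic, hence constants that form the relation.\<close>

lemma casoratian_eq_0_imp_dependent:
  assumes "\<And>i. i < s \<Longrightarrow> small_growth (u i)" "\<And>z. casoratian u s z = 0"
  shows "\<exists>c. (\<exists>i<s. c i \<noteq> 0) \<and> (\<forall>z. (\<Sum>i<s. c i * u i z) = 0)"
  using assms
proof (induction s)
  case 0
  then show ?case by simp
next
  case (Suc s)
  define M where "M z = Matrix.mat (Suc s) (Suc s) (\<lambda>(i, j). u i (z + of_nat j))" for z
  define A where "A i z = cofactor (M z) i s" for i z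
  have M: "M z \<in> carrier_mat (Suc s) (Suc s)" for z by (simp add: M_def)
  show ?case
  proof (cases "\<forall>z. casoratian u s z = 0")
    case True
    with Suc obtain c where "\<exists>i<s. c i \<noteq> 0" "\<forall>z. (\<Sum>i<s. c i * u i z) = 0"
      by (metis less_SucI)
    then show ?thesis
      by (intro exI[of _ "c(s := 0)"]) (auto simp: less_Suc_eq)
  next
    case False
    have A_s: "A s z = casoratian u s z" for z
    proof -
      have "mat_delete (M z) s s = Matrix.mat s s (\<lambda>(i, j). u i (z + of_nat j))"
        by (rule eq_matI) (simp_all add: mat_delete_def M_def)
      then show ?thesis by (simp add: A_def cofactor_def casoratian_def)
    qed
    \<comment> \<open>For \<open>j < s\<close> this is an expansion with a repeated column, for
      \<open>j = s\<close> the vanishing determinant itself.\<close>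
    have kernel: "(\<Sum>i<Suc s. A i z * u i (z + of_nat j)) = 0" if "j < Suc s" for j z
    proof -
      have "adj_mat (M z) * M z = 0\<^sub>m (Suc s) (Suc s)"
        using adj_mat(3)[OF M] Suc.prems(2)[of z] by (auto simp: casoratian_def M_def)
      then have "(adj_mat (M z) * M z) $$ (s, j) = 0" using that by simp
      then show ?thesis using that M
        by (simp add: adj_mat_def scalar_prod_def A_def M_def atLeast0LessThan)
    qed
    have A_growth: "small_growth (A i)" if "i < Suc s" for i
    proof -
      have "mat_delete (M z) i s = Matrix.mat s s (\<lambda>(k, l). u (if k < i then k else Suc k) (z + of_nat l))" for z
        by (rule eq_matI) (simp_all add: mat_delete_def M_def)
      then have eq: "A i = (\<lambda>z. (-1) ^ (i + s) * Determinant.det (Matrix.mat s s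
          (\<lambda>(k, l). u (if k < i then k else Suc k) (z + of_nat l))))"
        by (simp add: A_def cofactor_def fun_eq_iff)
      show ?thesis
        unfolding eq using that by (intro small_growth_cmult small_growth_det small_growth_shift Suc.prems(1)) auto
    qed
    \<comment> \<open>The cofactor vectors at \<open>z\<close> and at \<open>z + 1\<close> both
      annihilate the columns at \<open>z + 1\<close>, ..., \<open>z + s\<close>. Their combination
      \<open>v\<close> has last entry 0, and the transpose of the invertible \<open>N\<close> kills
      the rest, so \<open>v\<close> is zero.\<close>
    have periodic: "A i (z + 1) * A s z = A i z * A s (z + 1)"
      if i: "i < Suc s" and ne: "A s (z + 1) \<noteq> 0" for i z
    proof -
      define v where "v k = A k (z + 1) * A s z - A k z * A s (z + 1)" for k
      define N where "N = Matrix.mat s s (\<lambda>(i, j). u i (z + 1 + of_nat j))"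
      have N: "N \<in> carrier_mat s s" by (simp add: N_def)
      have "(\<Sum>k<s. v k * u k (z + 1 + of_nat j)) = 0" if j: "j < s" for j
      proof -
        have "(\<Sum>k<Suc s. v k * u k (z + 1 + of_nat j)) =
            A s z * (\<Sum>k<Suc s. A k (z + 1) * u k (z + 1 + of_nat j)) -
            A s (z + 1) * (\<Sum>k<Suc s. A k z * u k (z + of_nat (Suc j)))"
          by (simp only: v_def sum_distrib_left sum_subtractf[symmetric])
             (auto intro!: sum.cong simp: algebra_simps)
        also have "\<dots> = 0" using kernel[of j "z + 1"] kernel[of "Suc j" z] j by simp
        finally show ?thesis by (simp add: v_def)
      qed
      then have "N\<^sup>T *\<^sub>v Matrix.vec s v = 0\<^sub>v s"
        by (intro eq_vecI) (auto simp: N_def scalar_prod_def atLeast0LessThan mult.commute)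
      moreover have "Determinant.det (N\<^sup>T) \<noteq> 0"
        using ne det_transpose[OF N] by (simp add: A_s casoratian_def N_def)
      ultimately have "Matrix.vec s v = 0\<^sub>v s"
        using det_0_iff_vec_prod_zero_field[of "N\<^sup>T" s] N by (metis transpose_carrier_mat vec_carrier)
      then have "v k = 0" if "k < s" for k using that by (metis index_vec index_zero_vec(1))
      then have "v i = 0" using i by (cases "i = s") (auto simp: v_def)
      then show ?thesis by (simp add: v_def)
    qed
    have "\<exists>c. \<forall>z. A i z = c * A s z" if "i < Suc s" for i
    proof -
      have "\<exists>z. A s z \<noteq> 0" using False by (simp add: A_s)
      from small_growth_periodic_quotient[OF A_growth[OF that] A_growth[of s] this periodic[OF that]]
      show ?thesis by auto
    qed
    then obtain c where c: "\<And>i z. i < Suc s \<Longrightarrow> A i z = c i * A s z" by metis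
    obtain z\<^sub>1 where "A s z\<^sub>1 \<noteq> 0" using False by (auto simp: A_s)
    have "c s \<noteq> 0"
    proof
      assume "c s = 0"
      then have "A s z\<^sub>1 = 0 * A s z\<^sub>1" by (subst c[OF lessI]) (simp only:)
      with \<open>A s z\<^sub>1 \<noteq> 0\<close> show False by simp
    qed
    \<comment> \<open>The column \<open>j = 0\<close> gives the relation times \<open>A s\<close>,
      which is then cancelled as a nonzero entire factor.\<close>
    have "A s z * (\<Sum>i<Suc s. c i * u i z) = 0" for z
    proof -
      have "A s z * (\<Sum>i<Suc s. c i * u i z) = (\<Sum>i<Suc s. A i z * u i (z + of_nat 0))"
        unfolding sum_distrib_left
      proof (intro sum.cong refl)
        fix i assume "i \<in> {..<Suc s}"
        then have "A i z = c i * A s z" by (intro c) simp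
        then show "A s z * (c i * u i z) = A i z * u i (z + of_nat 0)" by simp
      qed
      then show ?thesis using kernel[of 0 z] by simp
    qed
    moreover have "entire (\<lambda>z. \<Sum>i<Suc s. c i * u i z)"
      using Suc.prems(1) by (intro small_growth_entire small_growth_sum small_growth_cmult) auto
    moreover have "entire (A s)" by (intro small_growth_entire A_growth) simp
    ultimately have "\<forall>z. (\<Sum>i<Suc s. c i * u i z) = 0"
      using entire_mult_eq_0[of "A s" "\<lambda>z. \<Sum>i<Suc s. c i * u i z"] False by (auto simp: A_s)
    with \<open>c s \<noteq> 0\<close> show ?thesis by blast
  qed
qed

section \<open>Shifted powers and divisibility\<close>

text \<open>Newton's forward expansion expresses \<open>f (a + n)\<close> through the differences at
  \<open>a\<close>; the induction carries all difference orders along.\<close>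

lemma zero_on_ray_if_fdiff_zero:
  assumes "\<And>k. (fdiff ^^ k) f a = 0"
  shows "f (a + of_nat n) = 0"
proof -
  have "(fdiff ^^ k) f (a + of_nat n) = 0" for k
  proof (induction n arbitrary: k)
    case 0
    then show ?case using assms by simp
  next
    case (Suc n)
    have "fdiff ((fdiff ^^ k) f) (a + of_nat n) = 0" using Suc[of "Suc k"] by simp
    then show ?case using Suc[of k] by (simp add: fdiff_def[of "(fdiff ^^ k) f"] add_ac)
  qed
  from this[of 0] show ?thesis by simp
qed

text \<open>A length could only be missing if all differences vanished at \<open>a\<close>; then
  \<open>f\<close> would vanish on the ray from \<open>a\<close>, hence everywhere.\<close>

lemma zero_of_length_exists:
  assumes f: "small_growth f" "f w \<noteq> 0" and a: "f a = 0"
  obtains n where "zero_of_length f a n"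
proof -
  have "\<exists>n. (fdiff ^^ n) f a \<noteq> 0"
    using zero_on_ray_if_fdiff_zero[of f a] small_growth_eq_0_if_zero_on_ray[OF f(1), of a w] f(2) by blast
  define n where "n = (LEAST n. (fdiff ^^ n) f a \<noteq> 0)"
  have n: "(fdiff ^^ n) f a \<noteq> 0"
    unfolding n_def using \<open>\<exists>n. _\<close> by (rule LeastI_ex)
  have "(fdiff ^^ k) f a = 0" if "k < n" for k
    using not_less_Least[of k "\<lambda>n. (fdiff ^^ n) f a \<noteq> 0"] that by (auto simp: n_def)
  moreover have "n \<noteq> 0" using n a by (metis funpow_0)
  ultimately show ?thesis using n by (intro that[of n]) (auto simp: zero_of_length_def)
qed

text \<open>Zeros \<open>a\<close> of \<open>f\<close> and \<open>a + 1\<close> of \<open>g\<close>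
  give a common shifting divisor with both partial lengths 1, since (z - a)(z - (a + 1)) is the
  shifted square of \<open>z - a\<close>.\<close>

lemma relatively_shifting_prime_consecutive:
  assumes rp: "relatively_shifting_prime f g"
    and f: "small_growth f" "f w \<noteq> 0" and g: "small_growth g" "g w' \<noteq> 0"
    and a: "f a = 0"
  shows "g (a + 1) \<noteq> 0"
proof
  assume b: "g (a + 1) = 0"
  obtain m where m: "zero_of_length f a m" using zero_of_length_exists[OF f a] by blast
  obtain n where n: "zero_of_length g (a + 1) n" using zero_of_length_exists[OF g b] by blast
  obtain F where F: "entire F" "\<And>z. f z = (z - a) * F z"
    using entire_divide_linear[OF small_growth_entire[OF f(1)] a] by blast
  obtain G where G: "entire G" "\<And>z. g z = (z - (a + 1)) * G z"
    using entire_divide_linear[OF small_growth_entire[OF g(1)] b] by blast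
  have pow1: "shift_pow (\<lambda>w. w - c) 1 z = z - c" for c z
    by (simp add: shift_pow_def)
  have pow2: "shift_pow (\<lambda>w. w - a) (1 + 1) z = (z - a) * (z - (a + 1))" for z
    by (simp add: shift_pow_def numeral_2_eq_2 algebra_simps)
  have "1 \<le> m" "1 \<le> n" using m n by (auto simp: zero_of_length_def)
  moreover have "\<forall>z. f z * g z = shift_pow (\<lambda>w. w - a) (1 + 1) z * F z * G z"
    unfolding pow2 F(2) G(2) by (simp add: mult_ac)
  moreover have "\<forall>z. f z = shift_pow (\<lambda>w. w - a) 1 z * F z" "\<forall>z. g z = shift_pow (\<lambda>w. w - (a + 1)) 1 z * G z"
    unfolding pow1 using F(2) G(2) by blast+
  ultimately have "common_shifting_divisor f g a"
    unfolding common_shifting_divisor_def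
    by (intro exI[of _ a] exI[of _ "a + 1"] exI[of _ m] exI[of _ n] exI[of _ 1] exI[of _ F] exI[of _ G]
        conjI m n F(1) G(1) order_refl insertI1)
  with rp show False by (auto simp: relatively_shifting_prime_def)
qed

lemma shift_pow_eq_0_iff: "shift_pow f n z = 0 \<longleftrightarrow> (\<exists>k<n. f (z - of_nat k) = 0)"
  by (auto simp: shift_pow_def)

text \<open>A common zero \<open>z\<close> of the powers of length \<open>N\<close> yields
  consecutive zeros of the powers of length \<open>n\<close>: that of \<open>f\<close> at
  \<open>z\<close> and, with a factor to spare as \<open>N < n\<close>, that of \<open>g\<close> at
  \<open>z + 1\<close>.\<close>

lemma relatively_shifting_prime_no_common_zero:
  assumes rp: "relatively_shifting_prime (shift_pow f n) (shift_pow g n)" and N: "N < n"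
    and f: "small_growth f" "\<exists>w. f w \<noteq> 0" and g: "small_growth g" "\<exists>w. g w \<noteq> 0"
  shows "shift_pow f N z \<noteq> 0 \<or> shift_pow g N z \<noteq> 0"
proof (rule ccontr)
  assume "\<not> ?thesis"
  then obtain k l where k: "k < N" "f (z - of_nat k) = 0" and l: "l < N" "g (z - of_nat l) = 0"
    by (auto simp: shift_pow_eq_0_iff)
  have nz: "\<exists>w. shift_pow h n w \<noteq> 0" if "small_growth h" "\<exists>w. h w \<noteq> 0" for h
  proof -
    have "\<exists>w. \<forall>k\<in>{..<n}. h (w - of_nat k) \<noteq> 0"
    proof (rule entire_common_nonzero)
      show "entire (\<lambda>w. h (w - of_nat k))" for k
        by (intro small_growth_entire small_growth_shift_minus that)
      show "\<exists>w. h (w - of_nat k) \<noteq> 0" for k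
        using that(2) by (metis add_diff_cancel_right')
    qed simp
    then show ?thesis by (auto simp: shift_pow_eq_0_iff)
  qed
  obtain w where w: "shift_pow f n w \<noteq> 0" using nz[OF f] by blast
  obtain w' where w': "shift_pow g n w' \<noteq> 0" using nz[OF g] by blast
  have "shift_pow f n z = 0" using k N by (auto simp: shift_pow_eq_0_iff intro!: exI[of _ k])
  moreover have "shift_pow g n (z + 1) = 0"
    using l N by (auto simp: shift_pow_eq_0_iff intro!: exI[of _ "Suc l"])
  ultimately show False
    using relatively_shifting_prime_consecutive[OF rp small_growth_shift_pow[OF f(1)] w
        small_growth_shift_pow[OF g(1)] w'] by blast
qed

section \<open>Divisibility by pairwise coprime entire functions\<close>

text \<open>Glue \<open>p / Q\<close> off the zeros of \<open>Q\<close> with \<open>q / P\<close>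
  off the zeros of \<open>P\<close>: they agree on the overlap, and coprimality makes these open
  sets cover the plane, so no multiplicities need comparing.\<close>

lemma entire_coprime_mult_dvd:
  assumes "entire P" "entire Q" "entire p" "entire q"
    and eq: "\<And>z. P z * p z = Q z * q z" and cop: "\<And>z. P z \<noteq> 0 \<or> Q z \<noteq> 0"
  obtains d where "entire d" "\<And>z. P z * p z = P z * Q z * d z"
proof
  define d where "d = (\<lambda>z. if Q z \<noteq> 0 then p z / Q z else q z / P z)"
  have op: "open {z. h z \<noteq> 0}" if "entire h" for h :: "complex \<Rightarrow> complex"
    using open_Collect_neq[of h "\<lambda>_. 0"] entire_continuous_on[OF that, of UNIV]
    by simp
  have "d holomorphic_on {z. Q z \<noteq> 0}"
  proof (rule holomorphic_transform)
    show "(\<lambda>z. p z / Q z) holomorphic_on {z. Q z \<noteq> 0}"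
      using assms by (intro holomorphic_on_divide) (auto intro: holomorphic_on_subset)
  qed (auto simp: d_def)
  moreover have "d holomorphic_on {z. P z \<noteq> 0}"
  proof (rule holomorphic_transform)
    show "(\<lambda>z. q z / P z) holomorphic_on {z. P z \<noteq> 0}"
      using assms by (intro holomorphic_on_divide) (auto intro: holomorphic_on_subset)
    show "q z / P z = d z" if "z \<in> {z. P z \<noteq> 0}" for z
      using that eq[of z] by (auto simp: d_def field_simps)
  qed
  ultimately have "d holomorphic_on ({z. Q z \<noteq> 0} \<union> {z. P z \<noteq> 0})"
    using op assms by (intro holomorphic_on_Un) auto
  moreover have "{z. Q z \<noteq> 0} \<union> {z. P z \<noteq> 0} = UNIV" using cop by auto
  ultimately show "entire d" by simp
  show "P z * p z = P z * Q z * d z" for z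
    using eq[of z] cop[of z] by (auto simp: d_def)
qed

lemma entire_coprime_prod_dvd:
  assumes "finite I" "\<And>i. i \<in> I \<Longrightarrow> entire (P i)" "entire f"
    and "\<And>i. i \<in> I \<Longrightarrow> \<exists>q. entire q \<and> (\<forall>z. f z = P i z * q z)"
    and "\<And>i j z. i \<in> I \<Longrightarrow> j \<in> I \<Longrightarrow> i \<noteq> j \<Longrightarrow> P i z \<noteq> 0 \<or> P j z \<noteq> 0"
  shows "\<exists>q. entire q \<and> (\<forall>z. f z = (\<Prod>i\<in>I. P i z) * q z)"
  using assms(1,2,4,5)
proof (induction I)
  case empty
  then show ?case using assms(3) by auto
next
  case (insert i I)
  obtain p where p: "entire p" "\<And>z. f z = P i z * p z"
    using insert.prems(2)[of i] by auto
  obtain q where q: "entire q" "\<And>z. f z = (\<Prod>i\<in>I. P i z) * q z"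
    using insert.IH insert.prems by (metis insertCI)
  have "entire (\<lambda>z. \<Prod>i\<in>I. P i z)"
    using insert.prems(1) by (intro holomorphic_on_prod) auto
  moreover have "P i z \<noteq> 0 \<or> (\<Prod>i\<in>I. P i z) \<noteq> 0" for z
    using insert.prems(3)[of i _ z] insert.hyps by (metis insertCI prod_zero_iff)
  ultimately obtain d where "entire d" "\<And>z. P i z * p z = P i z * (\<Prod>i\<in>I. P i z) * d z"
    using entire_coprime_mult_dvd[of "P i" "\<lambda>z. \<Prod>i\<in>I. P i z" p q] p q insert.prems(1)[of i]
    by (metis insertI1)
  then show ?case using p insert.hyps by auto
qed

text \<open>The shifted powers at \<open>z\<close>, ..., \<open>z + (m - 1)\<close> all contain the
  values of \<open>f\<close> at \<open>z\<close>, \<open>z - 1\<close>, ...,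
  \<open>z - (n - m)\<close>, a block of length \<open>Suc n - m\<close>.\<close>

lemma shift_pow_shift_factor:
  assumes "j < m" "m \<le> Suc n"
  shows "shift_pow f n (z + of_nat j) = shift_pow f (Suc n - m) z *
    (\<Prod>k\<in>{..<n} - {j..<j + (Suc n - m)}. f (z + of_nat j - of_nat k))"
proof -
  have "shift_pow f (Suc n - m) z = (\<Prod>k\<in>{j..<j + (Suc n - m)}. f (z + of_nat j - of_nat k))"
    unfolding shift_pow_def
    by (rule prod.reindex_bij_witness[of _ "\<lambda>k. k - j" "\<lambda>k. k + j"]) auto
  moreover have "{j..<j + (Suc n - m)} \<subseteq> {..<n}" using assms by auto
  ultimately show ?thesis
    unfolding shift_pow_def[of f n] by (subst prod.subset_diff[of "{j..<j + (Suc n - m)}"]) (auto simp: mult.commute)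
qed

text \<open>The block shared by all entries of row \<open>l\<close> comes out of the determinant;
  the cofactor \<open>q\<close> keeps the leftover factors \<open>r j\<close> in that row.\<close>

lemma shift_pow_dvd_casoratian:
  assumes u: "\<And>i. i < m \<Longrightarrow> small_growth (u i)" and f: "small_growth f"
    and l: "l < m" "u l = shift_pow f n" and m: "m \<le> Suc n"
  shows "\<exists>q. entire q \<and> (\<forall>z. casoratian u m z = shift_pow f (Suc n - m) z * q z)"
proof -
  define r where "r j z = (\<Prod>k\<in>{..<n} - {j..<j + (Suc n - m)}. f (z + of_nat j - of_nat k))" for j z
  define q where "q z = Determinant.det (Matrix.mat m m (\<lambda>(i, j). if i = l then r j z else u i (z + of_nat j)))" for z
  have r: "small_growth (r j)" for j
    unfolding r_def[abs_def] using small_growth_shift[OF f, of "of_nat j - of_nat k" for k]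
    by (intro small_growth_prod) (simp add: algebra_simps)
  have "small_growth q"
    unfolding q_def[abs_def]
  proof (rule small_growth_det)
    fix i j assume "i < m" "j < m"
    then show "small_growth (\<lambda>z. if i = l then r j z else u i (z + of_nat j))"
      using r u by (cases "i = l") (auto intro: small_growth_shift)
  qed
  moreover have "casoratian u m z = shift_pow f (Suc n - m) z * q z" for z
  proof -
    have "casoratian u m z = Determinant.det (Matrix.mat m m (\<lambda>(i, j).
        (if i = l then shift_pow f (Suc n - m) z else 1) * (if i = l then r j z else u i (z + of_nat j))))"
      unfolding casoratian_def
      by (intro arg_cong[where f = Determinant.det] cong_mat)
         (auto simp: l(2) r_def shift_pow_shift_factor[OF _ m])
    also have "\<dots> = (\<Prod>i<m. if i = l then shift_pow f (Suc n - m) z else 1) * q z"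
      unfolding q_def by (rule det_mat_scale_rows)
    also have "(\<Prod>i<m. if i = l then shift_pow f (Suc n - m) z else 1) = shift_pow f (Suc n - m) z"
      using l(1) by simp
    finally show ?thesis .
  qed
  ultimately show ?thesis using small_growth_entire by blast
qed

section \<open>Size estimates on good circles\<close>

text \<open>Pulling \<open>f i z ^ n\<close> out of row \<open>i\<close> leaves products of
  \<open>n\<close> ratios close to 1, so the remaining matrix is near the all-ones matrix. The
  arguments differ from \<open>z\<close> by \<open>j - k\<close>, whence the range
  \<open>m + n\<close>.\<close>

lemma norm_casoratian_shift_pow_le:
  fixes f :: "nat \<Rightarrow> complex \<Rightarrow> complex"
  assumes m: "m \<ge> 2" and ne: "\<And>i. i < m \<Longrightarrow> f i z \<noteq> 0"
    and close: "\<And>i w. i < m \<Longrightarrow> norm w \<le> real (m + n) \<Longrightarrow> norm (f i (z + w) - f i z) \<le> \<delta> * norm (f i z)"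
  shows "norm (casoratian (\<lambda>i. shift_pow (f i) n) m z) \<le>
    (\<Prod>i<m. norm (f i z) ^ n) * (fact m * ((1 + \<delta>) ^ (n * m) - 1))"
proof -
  define q where "q i j = (\<Prod>k<n. f i (z + (of_nat j - of_nat k)) / f i z)" for i j
  have "casoratian (\<lambda>i. shift_pow (f i) n) m z =
      Determinant.det (Matrix.mat m m (\<lambda>(i, j). f i z ^ n * q i j))"
    unfolding casoratian_def
    by (intro arg_cong[where f = Determinant.det] cong_mat)
       (auto simp: q_def shift_pow_def prod_dividef ne algebra_simps)
  also have "\<dots> = (\<Prod>i<m. f i z ^ n) * Determinant.det (Matrix.mat m m (\<lambda>(i, j). q i j))"
    by (rule det_mat_scale_rows)
  also have "norm \<dots> = (\<Prod>i<m. norm (f i z) ^ n) * norm (Determinant.det (Matrix.mat m m (\<lambda>(i, j). q i j)))"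
    by (simp add: norm_mult prod_norm[symmetric] norm_power)
  also have "\<dots> \<le> (\<Prod>i<m. norm (f i z) ^ n) * (fact m * (((1 + \<delta>) ^ n) ^ m - 1))"
  proof (intro mult_left_mono det_near_ones_le m)
    fix i j assume i: "i < m" and j: "j < m"
    have "norm (q i j - 1) \<le> (\<Prod>k<n. 1 + \<delta>) - 1"
      unfolding q_def
    proof (rule norm_prod_minus1_le)
      fix k assume k: "k \<in> {..<n}"
      have "norm (of_nat j - of_nat k :: complex) \<le> norm (of_nat j :: complex) + norm (of_nat k :: complex)"
        by (rule norm_triangle_ineq4)
      then have "norm (of_nat j - of_nat k :: complex) \<le> real (m + n)"
        using j k by simp
      then have "norm (f i (z + (of_nat j - of_nat k)) - f i z) \<le> \<delta> * norm (f i z)"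
        by (rule close[OF i])
      moreover have "f i (z + (of_nat j - of_nat k)) / f i z - 1 = (f i (z + (of_nat j - of_nat k)) - f i z) / f i z"
        using ne[OF i] by (simp add: diff_divide_distrib)
      ultimately show "norm (f i (z + (of_nat j - of_nat k)) / f i z - 1) \<le> 1 + \<delta> - 1"
        using ne[OF i] by (simp add: norm_divide field_simps)
    qed
    then show "norm (q i j - 1) \<le> (1 + \<delta>) ^ n - 1" by simp
  qed (auto intro!: prod_nonneg)
  finally show ?thesis by (simp add: power_mult)
qed

lemma norm_shift_pow_ge:
  assumes close: "\<And>w. norm w \<le> real n \<Longrightarrow> norm (f (z + w) - f z) \<le> 1 / 2 * norm (f z)"
  shows "(norm (f z) / 2) ^ n \<le> norm (shift_pow f n z)"
proof -
  have "norm (f z) / 2 \<le> norm (f (z - of_nat k))" if "k < n" for k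
    using close[of "- of_nat k"] that norm_triangle_ineq2[of "f z" "f (z - of_nat k)"]
    by (simp add: norm_minus_commute)
  then have "(\<Prod>k<n. norm (f z) / 2) \<le> (\<Prod>k<n. norm (f (z - of_nat k)))"
    by (intro prod_mono) auto
  then show ?thesis by (simp add: shift_pow_def prod_norm)
qed

text \<open>Exponent bookkeeping at a point where \<open>x l\<close> is largest. Each of the
  \<open>m\<close> factors on the right has surplus power \<open>n - N = m - 1\<close>, at most that
  of \<open>x l\<close>, in total \<open>x l ^ (m * (m - 1))\<close>. On the left
  \<open>x l ^ N\<close> supplies exactly this and a further \<open>x l ^ e\<close>; the halves give
  the power of 2.\<close>

lemma max_weight_cancel:
  fixes x :: "'a \<Rightarrow> real"
  assumes I: "finite I" "card I = Suc m" "l \<in> I"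
    and x: "\<And>i. i \<in> I \<Longrightarrow> 0 < x i \<and> x i \<le> x l" and D: "0 \<le> D"
    and n: "n = N + (m - 1)" and N: "N = e + m * (m - 1)"
    and le: "H * (\<Prod>i\<in>I. (x i / 2) ^ N) \<le> (\<Prod>i\<in>I - {l}. x i ^ n) * D"
  shows "H * x l ^ e \<le> 2 ^ (N * Suc m) * D"
proof -
  let ?Q = "(\<Prod>i\<in>I - {l}. x i ^ N) * x l ^ (m * (m - 1))"
  have xl: "0 < x l" using x I by blast
  have Q: "0 < ?Q" using x xl by (intro mult_pos_pos prod_pos zero_less_power) auto
  have "(\<Prod>i\<in>I. (x i / 2) ^ N) = (\<Prod>i\<in>I. x i ^ N) / 2 ^ (N * Suc m)"
    using I by (simp add: power_divide prod_dividef power_add flip: power_mult)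
  also have "(\<Prod>i\<in>I. x i ^ N) = x l ^ e * ?Q"
    using I by (simp add: prod.remove[of I l] N power_add mult_ac)
  finally have 1: "(\<Prod>i\<in>I. (x i / 2) ^ N) = x l ^ e * ?Q / 2 ^ (N * Suc m)" .
  have "(\<Prod>i\<in>I - {l}. x i ^ n) = (\<Prod>i\<in>I - {l}. x i ^ N) * (\<Prod>i\<in>I - {l}. x i ^ (m - 1))"
    by (simp add: n power_add prod.distrib)
  also have "\<dots> \<le> (\<Prod>i\<in>I - {l}. x i ^ N) * (\<Prod>i\<in>I - {l}. x l ^ (m - 1))"
    using x by (intro mult_left_mono prod_mono prod_nonneg) (auto intro!: power_mono simp: less_imp_le)
  also have "(\<Prod>i\<in>I - {l}. x l ^ (m - 1)) = x l ^ (m * (m - 1))"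
    using I by (simp add: mult.commute flip: power_mult)
  finally have "(\<Prod>i\<in>I - {l}. x i ^ n) * D \<le> ?Q * D"
    using D by (rule mult_right_mono)
  with le have "H * (x l ^ e * ?Q / 2 ^ (N * Suc m)) \<le> ?Q * D" unfolding 1 by linarith
  then have "H * x l ^ e * ?Q \<le> 2 ^ (N * Suc m) * D * ?Q"
    by (simp add: field_simps)
  then show ?thesis using Q by (rule mult_right_le_imp_le)
qed

lemma small_perturbation_exists:
  fixes A \<epsilon> :: real
  assumes "0 < \<epsilon>"
  obtains \<delta> where "0 < \<delta>" "\<delta> \<le> 1 / 2" "A * ((1 + \<delta>) ^ k - 1) < \<epsilon>"
proof -
  have "((\<lambda>\<delta>. A * ((1 + \<delta>) ^ k - 1)) \<longlongrightarrow> A * ((1 + 0) ^ k - 1)) (at_right 0)"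
    by (intro tendsto_intros)
  then have "eventually (\<lambda>\<delta>. A * ((1 + \<delta>) ^ k - 1) < \<epsilon>) (at_right 0)"
    using assms by (intro order_tendstoD) auto
  moreover have "eventually (\<lambda>\<delta>. 0 < \<delta> \<and> \<delta> < 1 / 2) (at_right (0::real))"
    using eventually_at_right_real[of 0 "1 / 2"] by simp
  ultimately have "eventually (\<lambda>\<delta>. A * ((1 + \<delta>) ^ k - 1) < \<epsilon> \<and> 0 < \<delta> \<and> \<delta> < 1 / 2) (at_right 0)"
    by (rule eventually_conj)
  then have "\<exists>\<delta>. A * ((1 + \<delta>) ^ k - 1) < \<epsilon> \<and> 0 < \<delta> \<and> \<delta> < 1 / 2"
    by (intro eventually_happens') (auto simp: trivial_limit_at_right_real)
  then show ?thesis using that by force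
qed

section \<open>The bound on the exponent\<close>

theorem theorem5p2:
  fixes m n :: nat and f :: "nat \<Rightarrow> complex \<Rightarrow> complex"
  assumes "m \<ge> 2"
    and "\<And>i. i \<in> {1..m+1} \<Longrightarrow> entire (f i)"
    and "\<And>i. i \<in> {1..m+1} \<Longrightarrow> \<not> f i constant_on UNIV"
    and "\<And>i. i \<in> {1..m+1} \<Longrightarrow> growth_order (f i) < 1"
    and "\<And>z. (\<Sum>i=1..m. shift_pow (f i) n z) = shift_pow (f (m+1)) n z"
    and "pairwise (\<lambda>i j. relatively_shifting_prime (shift_pow (f i) n) (shift_pow (f j) n)) {1..m+1}"
    and "lin_indep_family {1..m} (\<lambda>i. shift_pow (f i) n)"
  shows "n \<le> m^2 - 2"
proof (rule ccontr)
  assume "\<not> n \<le> m\<^sup>2 - 2"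
  moreover have "2 * m \<le> m\<^sup>2" using assms(1) by (simp add: power2_eq_square)
  ultimately have n_ge: "m\<^sup>2 \<le> n + 1" "m < n" using assms(1) by auto
  \<comment> \<open>The divisor of \<open>C\<close> has N(m + 1) factors and its upper bound nm, and
    N(m + 1) - nm = n + 1 - m^2. The assumed failure of the claim makes this nonnegative, so the
    natural subtraction is exact.\<close>
  define e where "e = n + 1 - m\<^sup>2"
  define N where "N = Suc n - m"
  have N_less: "N < n" using assms(1) n_ge by (simp add: N_def)
  have n_eq: "n = N + (m - 1)" using n_ge assms(1) by (simp add: N_def)
  have N_eq: "N = e + m * (m - 1)"
    using n_ge assms(1) by (simp add: N_def e_def power2_eq_square diff_mult_distrib2)
  let ?I = "{1..m+1}"
  let ?g = "\<lambda>i. shift_pow (f i) n"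
  have f: "small_growth (f i)" if "i \<in> ?I" for i
    using assms(2,4) that by (blast intro: small_growth_if_growth_order_less_1)
  have f_ne: "\<exists>w. f i w \<noteq> 0" if "i \<in> ?I" for i
    using assms(3)[OF that] by (auto simp: constant_on_def)
  define C where "C = casoratian (\<lambda>i. ?g (Suc i)) m"
  \<comment> \<open>\<open>\<sigma> l\<close> enumerates all indices but \<open>l\<close>, the last function taking the place of the \<open>l\<close>th.\<close>
  define \<sigma> where "\<sigma> l i = (if Suc i = l then m + 1 else Suc i)" for l i
  have \<sigma>: "bij_betw (\<sigma> l) {..<m} (?I - {l})" if "l \<in> ?I" for l
    using that
    by (intro bij_betw_byWitness[where f' = "\<lambda>i. if i = m + 1 then l - 1 else i - 1"])
       (auto simp: \<sigma>_def split: if_splits)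
  have \<sigma>_in: "\<sigma> l i \<in> ?I" if "i < m" for l i using that by (auto simp: \<sigma>_def)
  \<comment> \<open>The last shifted power is the sum of the others and takes the omitted row's
    place, so the determinant is unchanged, without a sign.\<close>
  have C_omit: "casoratian (\<lambda>i. ?g (\<sigma> l i)) m = C" if l: "l \<in> ?I" for l
  proof
    fix z
    show "casoratian (\<lambda>i. ?g (\<sigma> l i)) m z = C z"
    proof (cases "l = m + 1")
      case True
      then show ?thesis
        unfolding C_def casoratian_def
        by (intro arg_cong[where f = Determinant.det] cong_mat) (auto simp: \<sigma>_def)
    next
      case False
      have "?g (m + 1) = (\<lambda>z. \<Sum>i<m. ?g (Suc i) z)"
        using assms(5) by (auto simp: sum.atLeast1_atMost_eq)
      then have "(\<lambda>i. ?g (\<sigma> l i)) = (\<lambda>i. ?g (Suc i))(l - 1 := \<lambda>z. \<Sum>i<m. ?g (Suc i) z)"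
        using l by (auto simp: \<sigma>_def fun_eq_iff)
      then show ?thesis
        unfolding C_def using l False by (simp only:) (rule casoratian_sum_row, auto)
    qed
  qed
  \<comment> \<open>Omitting some \<open>l\<close> other than \<open>i\<close> puts
    \<open>f i\<close> into a row, also for \<open>i = m + 1\<close>.\<close>
  have C_dvd: "\<exists>q. entire q \<and> (\<forall>z. C z = shift_pow (f i) N z * q z)" if i: "i \<in> ?I" for i
  proof -
    have "\<exists>l\<in>?I. l \<noteq> i" using assms(1) by (intro bexI[of _ "if i = 1 then 2 else 1"]) auto
    then obtain l where l: "l \<in> ?I" "l \<noteq> i" by blast
    then have "i \<in> \<sigma> l ` {..<m}" using \<sigma>[OF l(1)] i by (simp add: bij_betw_def)
    then obtain k where k: "k < m" "\<sigma> l k = i" by auto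
    have "small_growth (?g (\<sigma> l j))" if "j < m" for j
      by (intro small_growth_shift_pow f \<sigma>_in that)
    from shift_pow_dvd_casoratian[of m "\<lambda>j. ?g (\<sigma> l j)" "f i" k n, OF this f[OF i] k(1)] show ?thesis
      using k(2) n_ge by (simp add: C_omit[OF l(1)] N_def)
  qed
  have "entire C" unfolding C_def
    by (intro small_growth_entire small_growth_casoratian small_growth_shift_pow f) auto
  then have "\<exists>H. entire H \<and> (\<forall>z. C z = (\<Prod>i\<in>?I. shift_pow (f i) N z) * H z)"
  proof (intro entire_coprime_prod_dvd C_dvd)
    show "entire (shift_pow (f i) N)" if "i \<in> ?I" for i
      by (intro small_growth_entire small_growth_shift_pow f that)
    show "shift_pow (f i) N z \<noteq> 0 \<or> shift_pow (f j) N z \<noteq> 0"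
      if "i \<in> ?I" "j \<in> ?I" "i \<noteq> j" for i j z
      using assms(6) that by (intro relatively_shifting_prime_no_common_zero[OF _ N_less] f f_ne)
        (auto simp: pairwise_def)
  qed auto
  then obtain H where H: "entire H" "\<And>z. C z = (\<Prod>i\<in>?I. shift_pow (f i) N z) * H z" by blast
  \<comment> \<open>\<open>H\<close> decays like \<open>o(1) / max\<^sub>i \<bar>f\<^sub>i\<bar> ^ e\<close> on good circles; the factor \<open>f 1 ^ e\<close> makes up for
    points where all the functions are small.\<close>
  define F where "F = (\<lambda>z. H z * f 1 z ^ e)"
  have "entire F" unfolding F_def using H(1) assms(2)[of 1] by (auto intro!: holomorphic_intros)
  \<comment> \<open>Good circles need a centre at which none of the functions vanishes.\<close>
  have "\<exists>b. \<forall>i\<in>?I. f i b \<noteq> 0"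
    by (rule entire_common_nonzero) (use assms(2) f_ne in auto)
  then obtain b where b: "\<And>i. i \<in> ?I \<Longrightarrow> f i b \<noteq> 0" by blast
  have F_small: "norm (F z) \<le> \<epsilon>" if \<epsilon>: "\<epsilon> > 0" for \<epsilon> z
  proof -
    \<comment> \<open>The quantity kept below \<open>\<epsilon>\<close> is the final bound for
      \<open>F\<close> on the circle, so \<open>\<delta>\<close> is fixed before the circle.\<close>
    obtain \<delta> where \<delta>: "0 < \<delta>" "\<delta> \<le> 1 / 2" "2 ^ (N * Suc m) * fact m * ((1 + \<delta>) ^ (n * m) - 1) < \<epsilon>"
      using small_perturbation_exists[OF \<epsilon>] by blast
    obtain r where r: "r > norm (z - b)"
      "\<And>i z w. i \<in> ?I \<Longrightarrow> norm (z - b) = r \<Longrightarrow> norm w \<le> real (m + n) \<Longrightarrow>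
         f i z \<noteq> 0 \<and> norm (f i (z + w) - f i z) \<le> \<delta> * norm (f i z)"
      using good_circles[of ?I f b \<delta> "norm (z - b)" "real (m + n)"] f b \<delta>(1) by blast
    show ?thesis
    proof (rule maximum_modulus_circle[OF \<open>entire F\<close>])
      fix w assume w: "norm (w - b) = r"
      have ne: "f i w \<noteq> 0" if "i \<in> ?I" for i
        using r(2)[OF that w, of 0] by simp
      define x where "x i = norm (f i w)" for i
      \<comment> \<open>The dominant index varies with \<open>w\<close>; this is harmless because
        every omission yields the same \<open>C\<close>.\<close>
      obtain l where l: "l \<in> ?I" "\<And>i. i \<in> ?I \<Longrightarrow> x i \<le> x l"
        using Max_in[of "x ` ?I"] Max_ge[of "x ` ?I"] by (auto simp del: Max_in Max_ge)
      define D where "D = fact m * ((1 + \<delta>) ^ (n * m) - 1)"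
      have D: "0 \<le> D" using \<delta>(1) by (simp add: D_def)
      have "norm (C w) \<le> (\<Prod>i<m. x (\<sigma> l i) ^ n) * D"
        unfolding C_omit[OF l(1), symmetric] x_def D_def
        using r(2)[OF _ w] \<sigma>_in ne
        by (intro norm_casoratian_shift_pow_le[where f = "\<lambda>i. f (\<sigma> l i)"] assms(1)) auto
      also have "(\<Prod>i<m. x (\<sigma> l i) ^ n) = (\<Prod>i\<in>?I - {l}. x i ^ n)"
        by (rule prod.reindex_bij_betw[OF \<sigma>[OF l(1)]])
      finally have upper: "norm (C w) \<le> (\<Prod>i\<in>?I - {l}. x i ^ n) * D" .
      have "(\<Prod>i\<in>?I. (x i / 2) ^ N) \<le> (\<Prod>i\<in>?I. norm (shift_pow (f i) N w))"
      proof (intro prod_mono conjI)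
        fix i assume i: "i \<in> ?I"
        have "norm (f i (w + v) - f i w) \<le> 1 / 2 * norm (f i w)" if "norm v \<le> real N" for v
        proof -
          have "norm (f i (w + v) - f i w) \<le> \<delta> * norm (f i w)"
            using r(2)[OF i w, of v] that N_less by simp
          also have "\<dots> \<le> 1 / 2 * norm (f i w)" using \<delta>(2) by (intro mult_right_mono) auto
          finally show ?thesis .
        qed
        then show "(x i / 2) ^ N \<le> norm (shift_pow (f i) N w)"
          unfolding x_def by (rule norm_shift_pow_ge)
      qed (simp add: x_def)
      then have "norm (H w) * (\<Prod>i\<in>?I. (x i / 2) ^ N) \<le> norm (C w)"
        by (simp add: H(2) norm_mult prod_norm mult.commute mult_left_mono)
      with upper have "norm (H w) * (\<Prod>i\<in>?I. (x i / 2) ^ N) \<le> (\<Prod>i\<in>?I - {l}. x i ^ n) * D"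
        by linarith
      then have "norm (H w) * x l ^ e \<le> 2 ^ (N * Suc m) * D"
        using l ne by (intro max_weight_cancel[where I = ?I, OF _ _ _ _ D n_eq N_eq]) (simp_all add: x_def)
      moreover have "norm (F w) \<le> norm (H w) * x l ^ e"
        unfolding F_def norm_mult norm_power using l(2)[of 1]
        by (intro mult_left_mono power_mono) (auto simp: x_def)
      ultimately show "norm (F w) \<le> \<epsilon>" using \<delta>(3) by (simp add: D_def mult.assoc)
    qed (use r(1) in simp)
  qed
  have "norm (F z) \<le> 0" for z
  proof (rule field_le_epsilon)
    fix \<epsilon> :: real assume "0 < \<epsilon>"
    then show "norm (F z) \<le> 0 + \<epsilon>" using F_small[of \<epsilon> z] by simp
  qed
  then have "H z * f 1 z ^ e = 0" for z by (simp add: F_def)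
  moreover have "f 1 b ^ e \<noteq> 0" using b[of 1] by simp
  moreover have "entire (\<lambda>z. f 1 z ^ e)" using assms(2)[of 1] by (auto intro!: holomorphic_intros)
  ultimately have "\<forall>z. H z = 0" using entire_mult_eq_0[OF H(1)] by blast
  then have "casoratian (\<lambda>i. ?g (Suc i)) m z = 0" for z using H(2)[of z] by (simp add: C_def)
  then obtain c where c: "\<exists>i<m. c i \<noteq> 0" "\<And>z. (\<Sum>i<m. c i * ?g (Suc i) z) = 0"
    using casoratian_eq_0_imp_dependent[of m "\<lambda>i. ?g (Suc i)"] small_growth_shift_pow f by auto
  have "(\<Sum>i=1..m. c (i - 1) * ?g i z) = 0" for z
    using c(2)[of z] by (simp add: sum.atLeast1_atMost_eq)
  with assms(7) have "\<forall>i\<in>{1..m}. c (i - 1) = 0"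
    unfolding lin_indep_family_def by (elim allE[of _ "\<lambda>i. c (i - 1)"]) blast
  then have "c i = 0" if "i < m" for i using bspec[of "{1..m}" "\<lambda>i. c (i - 1) = 0" "Suc i"] that by simp
  with c(1) show False by blast
qed

end
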